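(* Let $n \ge 2$ and let $w \in \mathfrak{S}_n$ be a fully supported permutation. Let $x > y$ be values appearing consecutively in this order in the one-line notation of $w$, i.e. $x = w(k)$ and $y = w(k+1)$ for some $1 \le k \le n-1$, with $x>y$. Then the following are equivalent: (i) $\{x,y\}$ is a forced right-perimeter tile for $w$; (ii) $x$ and $y$ do not appear together in a $321$-pattern of $w$; (iii) $x$ is a left-to-right maximum of $w$ and $y$ is a right-to-left minimum of $w$.
   Context: Permutations are written in one-line notation $w = w(1)w(2)\cdots w(n)$. A permutation $w \in \mathfrak{S}_n$ is fully supported if $\{w(1),\ldots,w(r)\} \ne \{1,\ldots,r\}$ for all $1 \le r < n$ (equivalently, every simple reflection appears in its reduced decompositions). Elnitsky polygon. For fully supported $w \in \mathfrak{S}_n$, $n \ge 2$, Elnitsky's polygon $X(w)$ is the equilateral $2n$-gon whose sides, read counterclockwise starting at the top vertex, are labeled $1,\ldots,n,w(n),\ldots,w(1)$, such that the first $n$ sides form half of a convex $2n$-gon and sides with the same label are parallel. Concretely: fix unit vectors $v_1,\ldots,v_n$ in the plane with angles $\pi < \theta_1 < \cdots < \theta_n < 2\pi$; with the top vertex at the origin, the leftside boundary is the path with vertices $v_1+\cdots+v_k$ ($0\le k\le n$), its $k$th edge labeled $k$, and the rightside boundary is the path with vertices $v_{w(1)}+\cdots+v_{w(k)}$ ($0 \le k \le n$), its $k$th edge labeled $w(k)$. Both paths end at the bottom vertex, and $X(w)$ is the region they bound. Tilings. A rhombic tiling of $X(w)$ is an (edge-to-edge) tiling by rhombi whose edges are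 all congruent and parallel to edges of $X(w)$ (unit rhombi with sides parallel to $v_i$ and $v_j$, $i \ne j$). $T(w)$ is the set of all rhombic tilings of $X(w)$. The labels of a tile are the labels $\{i,j\}$ of the sides of $X(w)$ to which its edges are parallel. In any tiling no two tiles have the same labels, so a tile is identified with its label set: "the tile $\{x,y\}$". Perimeter tiles. A tile of $T \in T(w)$ is a right-perimeter tile if it shares two consecutive edges with the rightside boundary of $X(w)$. The tile $\{x,y\}$ is a forced right-perimeter tile for $w$ if in every $T \in T(w)$ the tile $\{x,y\}$ is present and is a right-perimeter tile. Patterns. A $321$-pattern in $w$ is a triple of values $w(i)>w(j)>w(l)$ with $i<j<l$; two values appear together in a $321$-pattern if both belong to some such triple. A left-to-right maximum of $w$ is a value $w(i)$ with $w(i) > w(j)$ for all $j<i$; a right-to-left minimum is a value $w(i)$ with $w(i) < w(j)$ for all $j > i$. *)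

theory Defs
  imports "HOL-Analysis.Analysis" "HOL-Combinatorics.Permutations"
begin

text \<open>
  Permutations of size \<open>n\<close> are functions \<open>w\<close> with \<open>w permutes {1..n}\<close>; the one-line notation is
  \<open>w 1, \<dots>, w n\<close>. The plane is the type of complex numbers, and the unit vector labelled \<open>i\<close> is
  \<open>cis (\<theta> i)\<close>.
\<close>

definition fully_supported :: "nat \<Rightarrow> (nat \<Rightarrow> nat) \<Rightarrow> bool" where
  "fully_supported n w \<longleftrightarrow> (\<forall>r. 1 \<le> r \<and> r < n \<longrightarrow> w ` {1..r} \<noteq> {1..r})"

definition elnitsky_angles :: "nat \<Rightarrow> (nat \<Rightarrow> real) \<Rightarrow> bool" where
  "elnitsky_angles n \<theta> \<longleftrightarrow>
     (\<forall>i\<in>{1..n}. pi < \<theta> i \<and> \<theta> i < 2 * pi) \<and> strict_mono_on {1..n} \<theta>"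

text \<open>
  Vertices and edges of the path that starts at the top vertex \<open>0\<close> and whose \<open>k\<close>th edge
  (\<open>1 \<le> k \<le> n\<close>) is labelled \<open>u k\<close>. The leftside boundary is the case \<open>u = id\<close>, the rightside
  boundary the case \<open>u = w\<close>.
\<close>

definition path_vertex :: "(nat \<Rightarrow> real) \<Rightarrow> (nat \<Rightarrow> nat) \<Rightarrow> nat \<Rightarrow> complex" where
  "path_vertex \<theta> u k = (\<Sum>i=1..k. cis (\<theta> (u i)))"

definition path_edge :: "(nat \<Rightarrow> real) \<Rightarrow> (nat \<Rightarrow> nat) \<Rightarrow> nat \<Rightarrow> complex set" where
  "path_edge \<theta> u k = closed_segment (path_vertex \<theta> u (k - 1)) (path_vertex \<theta> u k)"

definition polygon_boundary :: "nat \<Rightarrow> (nat \<Rightarrow> real) \<Rightarrow> (nat \<Rightarrow> nat) \<Rightarrow> complex set" where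
  "polygon_boundary n \<theta> w =
     (\<Union>k\<in>{1..n}. path_edge \<theta> id k) \<union> (\<Union>k\<in>{1..n}. path_edge \<theta> w k)"

definition elnitsky_polygon :: "nat \<Rightarrow> (nat \<Rightarrow> real) \<Rightarrow> (nat \<Rightarrow> nat) \<Rightarrow> complex set" where
  "elnitsky_polygon n \<theta> w = polygon_boundary n \<theta> w \<union> inside (polygon_boundary n \<theta> w)"

definition rhombus :: "(nat \<Rightarrow> real) \<Rightarrow> complex \<Rightarrow> nat \<Rightarrow> nat \<Rightarrow> complex set" where
  "rhombus \<theta> p i j =
     convex hull {p, p + cis (\<theta> i), p + cis (\<theta> j), p + cis (\<theta> i) + cis (\<theta> j)}"

definition has_labels :: "(nat \<Rightarrow> real) \<Rightarrow> complex set \<Rightarrow> nat \<Rightarrow> nat \<Rightarrow> bool" where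
  "has_labels \<theta> t i j \<longleftrightarrow> (\<exists>p. t = rhombus \<theta> p i j)"

text \<open>
  The last condition is the edge-to-edge condition: any two tiles meet in a common face, i.e. in
  the empty set, a common vertex or a common edge (or they coincide).
\<close>

definition rhombic_tilings :: "nat \<Rightarrow> (nat \<Rightarrow> real) \<Rightarrow> (nat \<Rightarrow> nat) \<Rightarrow> complex set set set" where
  "rhombic_tilings n \<theta> w = {T. finite T \<and>
     (\<forall>t\<in>T. \<exists>i\<in>{1..n}. \<exists>j\<in>{1..n}. i \<noteq> j \<and> has_labels \<theta> t i j) \<and>
     \<Union>T = elnitsky_polygon n \<theta> w \<and>
     pairwise (\<lambda>s t. interior s \<inter> interior t = {}) T \<and>
     (\<forall>s\<in>T. \<forall>t\<in>T. (s \<inter> t) face_of s \<and> (s \<inter> t) face_of t)}"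

definition right_perimeter_tile ::
    "nat \<Rightarrow> (nat \<Rightarrow> real) \<Rightarrow> (nat \<Rightarrow> nat) \<Rightarrow> complex set \<Rightarrow> bool" where
  "right_perimeter_tile n \<theta> w t \<longleftrightarrow>
     (\<exists>k. 1 \<le> k \<and> k < n \<and> path_edge \<theta> w k edge_of t \<and> path_edge \<theta> w (k + 1) edge_of t)"

text \<open>
  No two tiles of a rhombic tiling have the same labels, so that the existential quantifier
  over \<open>t\<close> below is about the only possible tile with labels \<open>x\<close> and \<open>y\<close>.
\<close>

definition forced_right_perimeter_tile ::
    "nat \<Rightarrow> (nat \<Rightarrow> real) \<Rightarrow> (nat \<Rightarrow> nat) \<Rightarrow> nat \<Rightarrow> nat \<Rightarrow> bool" where
  "forced_right_perimeter_tile n \<theta> w x y \<longleftrightarrow>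
     (\<forall>T\<in>rhombic_tilings n \<theta> w. \<exists>t\<in>T. has_labels \<theta> t x y \<and> right_perimeter_tile n \<theta> w t)"

definition together_in_321_pattern :: "nat \<Rightarrow> (nat \<Rightarrow> nat) \<Rightarrow> nat \<Rightarrow> nat \<Rightarrow> bool" where
  "together_in_321_pattern n w x y \<longleftrightarrow>
     (\<exists>i j l. 1 \<le> i \<and> i < j \<and> j < l \<and> l \<le> n \<and> w i > w j \<and> w j > w l \<and>
        {x, y} \<subseteq> {w i, w j, w l})"

definition left_to_right_maximum :: "nat \<Rightarrow> (nat \<Rightarrow> nat) \<Rightarrow> nat \<Rightarrow> bool" where
  "left_to_right_maximum n w a \<longleftrightarrow>
     (\<exists>i\<in>{1..n}. a = w i \<and> (\<forall>j. 1 \<le> j \<and> j < i \<longrightarrow> w i > w j))"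

definition right_to_left_minimum :: "nat \<Rightarrow> (nat \<Rightarrow> nat) \<Rightarrow> nat \<Rightarrow> bool" where
  "right_to_left_minimum n w a \<longleftrightarrow>
     (\<exists>i\<in>{1..n}. a = w i \<and> (\<forall>j. i < j \<and> j \<le> n \<longrightarrow> w i < w j))"

end

theory Submission
  imports Defs
begin

text \<open>
  A tiling is swept by moving the rightside boundary to the leftside boundary through paths of
  tile edges. Along any such path other than the leftside boundary, follow for each edge the tile
  on its left: at the first edge off the leftside boundary this tile extends below the edge, and at
  the last one it extends above, so that at some vertex both types meet and one tile contains both
  edges. Exchanging these two edges removes the tile and undoes one inversion; hence the labels of
  every tile form an inversion of \<open>w\<close>. If \<open>x\<close> is a left-to-right maximum and \<open>y\<close> a right-to-left
  minimum, the tile at the edge \<open>x\<close> must therefore extend below, the one at \<open>y\<close> above, and they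
  coincide. Conversely, every sequence of such exchanges from \<open>w\<close> down to the identity yields a
  tiling, and a larger value before \<open>x\<close> (or a smaller one after \<open>y\<close>) can be moved across \<open>x\<close>
  (or \<open>y\<close>) first.
\<close>

subsection \<open>Unit rhombi\<close>

text \<open>All edge vectors \<open>v i\<close> point strictly downwards, so a path using them in
  any order meets each horizontal line at most once. Position relative to a path is therefore
  measured by horizontal shifts, and the polygon, defined topologically through
  \<open>inside\<close>, becomes the explicit closed set \<open>right_of id\<close> intersected with
  \<open>left_of w\<close>.

  The main obstacle is that a tiling is only required to cover this set with tiles meeting one
  another in common faces; nothing relates the sides of the polygon to sides of tiles. For the right
  boundary this relation has to be proved before the sweep can start, and every exchange then passes
  it on to the next path. Full support keeps the open edges of the right boundary off the left
  boundary, so that each of them does have a tile on its left.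

  For the converse, the tiles extending below and above one and the same edge overlap. A tiling
  whose tile at the edge \<open>x\<close> extends above, or whose tile at the edge \<open>y\<close>
  extends below, thus has no perimeter tile with labels \<open>x\<close> and
  \<open>y\<close>.\<close>

definition wedge :: "complex \<Rightarrow> complex \<Rightarrow> real" where
  "wedge a b = Re a * Im b - Im a * Re b"

lemma wedge_add_left: "wedge (a + b) c = wedge a c + wedge b c"
  and wedge_add_right: "wedge c (a + b) = wedge c a + wedge c b"
  and wedge_diff_left: "wedge (a - b) c = wedge a c - wedge b c"
  and wedge_diff_right: "wedge c (a - b) = wedge c a - wedge c b"
  and wedge_scaleR_left: "wedge (r *\<^sub>R a) c = r * wedge a c"
  and wedge_scaleR_right: "wedge c (r *\<^sub>R a) = r * wedge c a"
  and wedge_self: "wedge a a = 0"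
  and wedge_commute: "wedge a b = - wedge b a"
  and wedge_of_real_left: "wedge (of_real r) c = r * Im c"
  and wedge_of_real_right: "wedge c (of_real r) = - r * Im c"
  by (simp_all add: wedge_def algebra_simps)

lemmas wedge_simps = wedge_add_left wedge_add_right wedge_diff_left wedge_diff_right
  wedge_scaleR_left wedge_scaleR_right wedge_self wedge_of_real_left wedge_of_real_right

lemma wedge_sum_left: "wedge (\<Sum>i\<in>S. f i) c = (\<Sum>i\<in>S. wedge (f i) c)"
  by (induction S rule: infinite_finite_induct) (auto simp: wedge_def algebra_simps)

lemma wedge_cis: "wedge (cis a) (cis b) = sin (b - a)"
  by (simp add: wedge_def sin_diff algebra_simps)

locale elnitsky =
  fixes n :: nat and \<theta> :: "nat \<Rightarrow> real"
  assumes n_ge_2: "2 \<le> n"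
    and angles: "elnitsky_angles n \<theta>"
begin

abbreviation v :: "nat \<Rightarrow> complex" where "v i \<equiv> cis (\<theta> i)"
abbreviation P :: "(nat \<Rightarrow> nat) \<Rightarrow> nat \<Rightarrow> complex" where "P \<equiv> path_vertex \<theta>"
abbreviation E :: "(nat \<Rightarrow> nat) \<Rightarrow> nat \<Rightarrow> complex set" where "E \<equiv> path_edge \<theta>"
abbreviation R :: "complex \<Rightarrow> nat \<Rightarrow> nat \<Rightarrow> complex set" where "R \<equiv> rhombus \<theta>"

lemma Im_v: assumes "i \<in> {1..n}" shows "Im (v i) < 0"
proof -
  have "pi < \<theta> i" "\<theta> i < 2 * pi" using angles assms unfolding elnitsky_angles_def by auto
  then have "sin (\<theta> i) < 0" by (rule sin_lt_zero)
  then show ?thesis by simp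
qed

text \<open>All angles lie in an open half-circle, so a difference of two of them stays in the range
  where the sine is positive. This turns comparison of labels into comparison of
  orientations.\<close>

lemma wedge_v: assumes "i \<in> {1..n}" "j \<in> {1..n}" "i < j" shows "wedge (v i) (v j) > 0"
proof -
  have "pi < \<theta> i" "\<theta> j < 2 * pi" "\<theta> i < \<theta> j"
    using angles assms unfolding elnitsky_angles_def strict_mono_on_def by auto
  then have "0 < \<theta> j - \<theta> i" "\<theta> j - \<theta> i < pi" by linarith+
  then show ?thesis by (simp only: wedge_cis sin_gt_zero)
qed

lemma wedge_v_neq: assumes "i \<in> {1..n}" "j \<in> {1..n}" "i \<noteq> j" shows "wedge (v i) (v j) \<noteq> 0"
  using wedge_v[of i j] wedge_v[of j i] assms wedge_commute[of "v i" "v j"]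
  by (cases i j rule: linorder_cases) auto

lemma v_inj: assumes "i \<in> {1..n}" "j \<in> {1..n}" "v i = v j" shows "i = j"
  using wedge_v_neq[OF assms(1,2)] assms(3) wedge_self by metis

lemma coord_unique:
  assumes "i \<in> {1..n}" "j \<in> {1..n}" "i \<noteq> j"
    and "p + a *\<^sub>R v i + b *\<^sub>R v j = p + c *\<^sub>R v i + d *\<^sub>R v j"
  shows "a = c" "b = d"
proof -
  have *: "a *\<^sub>R v i + b *\<^sub>R v j = c *\<^sub>R v i + d *\<^sub>R v j" using assms(4) by (simp add: add.assoc)
  from arg_cong[OF *, of "\<lambda>z. wedge z (v j)"] show "a = c"
    using wedge_v_neq[OF assms(1-3)] by (simp add: wedge_simps)
  from arg_cong[OF *, of "\<lambda>z. wedge (v i) z"] show "b = d"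
    using wedge_v_neq[OF assms(1-3)] by (simp add: wedge_simps)
qed

lemma cramer:
  assumes "i \<in> {1..n}" "j \<in> {1..n}" "i \<noteq> j"
  shows "z = (wedge z (v j) / wedge (v i) (v j)) *\<^sub>R v i + (wedge (v i) z / wedge (v i) (v j)) *\<^sub>R v j"
proof -
  define D where "D = wedge (v i) (v j)"
  have D: "D \<noteq> 0" using wedge_v_neq[OF assms] by (simp add: D_def)
  have "D *\<^sub>R z = wedge z (v j) *\<^sub>R v i + wedge (v i) z *\<^sub>R v j"
    unfolding D_def wedge_def by (simp add: complex_eq_iff) algebra
  then have "(1 / D) *\<^sub>R (D *\<^sub>R z) = (1 / D) *\<^sub>R (wedge z (v j) *\<^sub>R v i + wedge (v i) z *\<^sub>R v j)" by simp
  then show ?thesis using D by (simp add: D_def scaleR_add_right)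
qed

text \<open>\<open>A\<close> and \<open>B\<close> are Cramer's coordinates of 1, the second with its
  sign reversed; they are positive because numerators and denominator are all negative. A horizontal
  step to the right thus gains in the larger label and loses in the smaller one.\<close>

lemma unit_right:
  assumes "i \<in> {1..n}" "j \<in> {1..n}" "j < i"
  obtains A B where "A > 0" "B > 0" "\<And>r. of_real r = (r * A) *\<^sub>R v i - (r * B) *\<^sub>R v j"
proof -
  have D: "wedge (v i) (v j) < 0" using wedge_v[OF assms(2,1,3)] wedge_commute[of "v i" "v j"] by simp
  define A where "A = Im (v j) / wedge (v i) (v j)"
  define B where "B = Im (v i) / wedge (v i) (v j)"
  have "A > 0" "B > 0" unfolding A_def B_def using D Im_v[OF assms(1)] Im_v[OF assms(2)]
    by (simp_all only: divide_neg_neg)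
  moreover have "of_real r = (r * A) *\<^sub>R v i - (r * B) *\<^sub>R v j" for r
    using cramer[of i j "of_real r"] assms unfolding A_def B_def by (simp add: wedge_simps)
  ultimately show ?thesis using that by blast
qed

section \<open>Coordinates, interior and faces of a rhombus\<close>

lemma mem_rhombus: "z \<in> R p i j \<longleftrightarrow>
  (\<exists>a b. 0 \<le> a \<and> a \<le> 1 \<and> 0 \<le> b \<and> b \<le> 1 \<and> z = p + a *\<^sub>R v i + b *\<^sub>R v j)"
proof -
  let ?f = "\<lambda>(a,b). a *\<^sub>R v i + b *\<^sub>R v j"
  have lin: "linear ?f" by (auto intro!: linearI simp: algebra_simps)
  let ?S = "{(0::real,0::real),(1,0),(0,1),(1,1)}"
  have hull: "convex hull ?S = {0..1} \<times> {0..1}"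
  proof -
    have "?S = {0,1} \<times> {0,1}" by auto
    then have "convex hull ?S = (convex hull {0,1}) \<times> (convex hull {0,1::real})"
      by (simp only: convex_hull_Times)
    moreover have "convex hull {0,1::real} = {0..1}"
      by (metis closed_segment_eq_real_ivl segment_convex_hull zero_le_one)
    ultimately show ?thesis by simp
  qed
  have "{p, p + v i, p + v j, p + v i + v j} = (\<lambda>x. p + x) ` ?f ` ?S"
    by (auto simp: add.assoc)
  then have "R p i j = (\<lambda>x. p + x) ` ?f ` ({0..1} \<times> {0..1})"
    unfolding rhombus_def hull[symmetric]
    by (simp only: convex_hull_translation convex_hull_linear_image[OF lin])
  also have "z \<in> \<dots> \<longleftrightarrow>
    (\<exists>a b. 0 \<le> a \<and> a \<le> 1 \<and> 0 \<le> b \<and> b \<le> 1 \<and> z = p + (a *\<^sub>R v i + b *\<^sub>R v j))"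
    by force
  finally show ?thesis by (simp only: add.assoc)
qed

lemma rhombus_commute: "R p i j = R p j i"
  by (simp add: rhombus_def insert_commute add.commute add.left_commute)

lemma convex_rhombus: "convex (R p i j)" and closed_rhombus: "closed (R p i j)"
  unfolding rhombus_def by (auto intro!: compact_imp_closed finite_imp_compact_convex_hull)

lemma interior_rhombus:
  assumes "i \<in> {1..n}" "j \<in> {1..n}" "i \<noteq> j" "0 < a" "a < 1" "0 < b" "b < 1"
  shows "p + a *\<^sub>R v i + b *\<^sub>R v j \<in> interior (R p i j)"
proof -
  define D where "D = wedge (v i) (v j)"
  have D: "D \<noteq> 0" using wedge_v_neq[OF assms(1-3)] by (simp add: D_def)
  define f where "f z = wedge (z - p) (v j) / D" for z
  define g where "g z = wedge (v i) (z - p) / D" for z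
  have "continuous_on UNIV f" "continuous_on UNIV g"
    unfolding f_def g_def wedge_def using D by (auto intro!: continuous_intros)
  then have "open {z. 0 < f z}" "open {z. f z < 1}" "open {z. 0 < g z}" "open {z. g z < 1}"
    by (auto intro!: open_Collect_less continuous_intros)
  then have "open ({z. 0 < f z} \<inter> {z. f z < 1} \<inter> ({z. 0 < g z} \<inter> {z. g z < 1}))" (is "open ?O")
    by (intro open_Int)
  moreover have "?O \<subseteq> R p i j"
  proof
    fix z assume z: "z \<in> ?O"
    have "z - p = f z *\<^sub>R v i + g z *\<^sub>R v j" using cramer[OF assms(1-3)] by (simp add: f_def g_def D_def)
    then have "z = p + f z *\<^sub>R v i + g z *\<^sub>R v j" by (simp add: algebra_simps)
    with z show "z \<in> R p i j" unfolding mem_rhombus by (intro exI[of _ "f z"] exI[of _ "g z"]) auto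
  qed
  moreover have "p + a *\<^sub>R v i + b *\<^sub>R v j \<in> ?O"
    using assms D by (simp add: f_def g_def wedge_simps D_def)
  ultimately show ?thesis by (meson interiorI)
qed

lemma closure_interior_rhombus:
  assumes "i \<in> {1..n}" "j \<in> {1..n}" "i \<noteq> j"
  shows "closure (interior (R p i j)) = R p i j"
  using convex_closure_interior[OF convex_rhombus] interior_rhombus[OF assms, of "1/2" "1/2" p]
    closed_rhombus by fastforce

text \<open>On these sides the coordinate along \<open>v j\<close> has an extreme value
  \<open>c\<close> of the unit interval, 0 or 1. A proper convex combination attains it only if both
  end points do.\<close>

lemma rhombus_side_face:
  assumes "i \<in> {1..n}" "j \<in> {1..n}" "i \<noteq> j"
  shows "closed_segment p (p + v i) face_of R p i j"
    and "closed_segment (p + v j) (p + v j + v i) face_of R p i j"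
proof -
  have "closed_segment (p + c *\<^sub>R v j) (p + c *\<^sub>R v j + v i) face_of R p i j" if c: "c = 0 \<or> c = 1" for c
    unfolding face_of_def
  proof (intro conjI ballI impI)
    have seg: "z \<in> closed_segment (p + c *\<^sub>R v j) (p + c *\<^sub>R v j + v i) \<longleftrightarrow>
      (\<exists>a. 0 \<le> a \<and> a \<le> 1 \<and> z = p + a *\<^sub>R v i + c *\<^sub>R v j)" for z
      unfolding in_segment by (auto simp: algebra_simps)
    show "closed_segment (p + c *\<^sub>R v j) (p + c *\<^sub>R v j + v i) \<subseteq> R p i j"
    proof
      fix z assume "z \<in> closed_segment (p + c *\<^sub>R v j) (p + c *\<^sub>R v j + v i)"
      then show "z \<in> R p i j" unfolding seg mem_rhombus using c by (metis zero_le_one order_refl)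
    qed
    fix a b x assume a: "a \<in> R p i j" and b: "b \<in> R p i j"
      and x: "x \<in> closed_segment (p + c *\<^sub>R v j) (p + c *\<^sub>R v j + v i)" and xab: "x \<in> open_segment a b"
    obtain a1 a2 where a12: "0 \<le> a1" "a1 \<le> 1" "0 \<le> a2" "a2 \<le> 1" "a = p + a1 *\<^sub>R v i + a2 *\<^sub>R v j"
      using a mem_rhombus by auto
    obtain b1 b2 where b12: "0 \<le> b1" "b1 \<le> 1" "0 \<le> b2" "b2 \<le> 1" "b = p + b1 *\<^sub>R v i + b2 *\<^sub>R v j"
      using b mem_rhombus by auto
    obtain x1 where x1: "x = p + x1 *\<^sub>R v i + c *\<^sub>R v j" using x seg by auto
    obtain u where u: "0 < u" "u < 1" "x = (1 - u) *\<^sub>R a + u *\<^sub>R b" using xab in_segment by metis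
    have "p + x1 *\<^sub>R v i + c *\<^sub>R v j =
      p + ((1 - u) * a1 + u * b1) *\<^sub>R v i + ((1 - u) * a2 + u * b2) *\<^sub>R v j"
      using x1 u(3) unfolding a12(5) b12(5) by (simp add: algebra_simps)
    then have eq: "c = (1 - u) * a2 + u * b2" using coord_unique[OF assms] by blast
    have "a2 = c \<and> b2 = c"
      using c
    proof
      assume "c = 0"
      moreover have "(1 - u) * a2 \<ge> 0" "u * b2 \<ge> 0" using u a12 b12 by auto
      ultimately have "(1 - u) * a2 = 0" "u * b2 = 0" using eq by linarith+
      then show ?thesis using u \<open>c = 0\<close> by auto
    next
      assume "c = 1"
      moreover have "(1 - u) * (1 - a2) \<ge> 0" "u * (1 - b2) \<ge> 0" using u a12 b12 by auto
      moreover have "(1 - u) * (1 - a2) + u * (1 - b2) = 1 - c" unfolding eq by algebra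
      ultimately have "(1 - u) * (1 - a2) = 0" "u * (1 - b2) = 0" by linarith+
      then show ?thesis using u \<open>c = 1\<close> by auto
    qed
    then show "a \<in> closed_segment (p + c *\<^sub>R v j) (p + c *\<^sub>R v j + v i)"
      "b \<in> closed_segment (p + c *\<^sub>R v j) (p + c *\<^sub>R v j + v i)"
      unfolding seg using a12 b12 by auto
  qed (simp)
  from this[of 0] this[of 1] show "closed_segment p (p + v i) face_of R p i j"
    "closed_segment (p + v j) (p + v j + v i) face_of R p i j" by simp_all
qed

text \<open>The end points of such a face are extreme points, hence vertices. Diagonals must be
  excluded by hand, since they can be unit vectors with a third label: their midpoint is the centre,
  which a proper face avoids. Sides traversed backwards are excluded because every
  \<open>v m\<close> points down.\<close>

lemma rhombus_face_unit_segment: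
  assumes ij: "i \<in> {1..n}" "j \<in> {1..n}" "i \<noteq> j" and m: "m \<in> {1..n}"
    and face: "closed_segment q (q + v m) face_of R p i j"
  shows "(m = i \<and> (q = p \<or> q = p + v j)) \<or> (m = j \<and> (q = p \<or> q = p + v i))"
proof -
  have "q extreme_point_of R p i j" "(q + v m) extreme_point_of R p i j"
    using extreme_point_of_face[OF face] extreme_point_of_segment by auto
  then have q: "q \<in> {p, p + v i, p + v j, p + v i + v j}" "q + v m \<in> {p, p + v i, p + v j, p + v i + v j}"
    unfolding rhombus_def using extreme_point_of_convex_hull by blast+
  have mid: "q + (1/2) *\<^sub>R v m \<in> closed_segment q (q + v m)"
    unfolding in_segment by (rule exI[of _ "1/2"]) (simp add: complex_eq_iff field_simps)
  have c: "p + (1/2) *\<^sub>R v i + (1/2) *\<^sub>R v j \<in> interior (R p i j)"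
    by (rule interior_rhombus) (use ij in auto)
  have ne: "closed_segment q (q + v m) \<noteq> R p i j"
  proof
    assume "closed_segment q (q + v m) = R p i j"
    then have "interior (closed_segment q (q + v m)) \<noteq> {}" using c by force
    then show False by (simp add: interior_closed_segment_ge2)
  qed
  have nmid: "q + (1/2) *\<^sub>R v m \<noteq> p + (1/2) *\<^sub>R v i + (1/2) *\<^sub>R v j"
    using face_of_disjoint_interior[OF face ne] mid c by (metis disjoint_iff)
  have Im: "Im (v i) < 0" "Im (v j) < 0" "Im (v m) < 0" using Im_v ij m by blast+
  have d1: "\<not> (q = p \<and> q + v m = p + v i + v j)"
    using nmid by (auto simp: add.assoc scaleR_add_right[symmetric])
  have d2: "\<not> (q = p + v i \<and> q + v m = p + v j)"
  proof
    assume *: "q = p + v i \<and> q + v m = p + v j"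
    then have "v i + v m = v j" by (metis add.assoc add_left_cancel)
    then have "Re (v i + v m) = Re (v j)" "Im (v i + v m) = Im (v j)" by simp_all
    with * have "q + (1/2) *\<^sub>R v m = p + (1/2) *\<^sub>R v i + (1/2) *\<^sub>R v j"
      by (simp add: complex_eq_iff algebra_simps)
    then show False using nmid by simp
  qed
  have d3: "\<not> (q = p + v j \<and> q + v m = p + v i)"
  proof
    assume *: "q = p + v j \<and> q + v m = p + v i"
    then have "v j + v m = v i" by (metis add.assoc add_left_cancel)
    then have "Re (v j + v m) = Re (v i)" "Im (v j + v m) = Im (v i)" by simp_all
    with * have "q + (1/2) *\<^sub>R v m = p + (1/2) *\<^sub>R v i + (1/2) *\<^sub>R v j"
      by (simp add: complex_eq_iff algebra_simps)
    then show False using nmid by simp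
  qed
  have up: "\<not> (q = p + v i \<and> q + v m = p)" "\<not> (q = p + v j \<and> q + v m = p)"
    "q \<noteq> p + v i + v j" "v m \<noteq> 0"
  proof -
    have *: "Im (q + v m) < Im q" using Im by simp
    show "\<not> (q = p + v i \<and> q + v m = p)"
    proof (rule notI, elim conjE)
      assume a: "q = p + v i" and b: "q + v m = p"
      have "Im (q + v m) = Im p" using b by (rule arg_cong)
      moreover have "Im q = Im p + Im (v i)" unfolding a by simp
      ultimately show False using * Im by linarith
    qed
    show "\<not> (q = p + v j \<and> q + v m = p)"
    proof (rule notI, elim conjE)
      assume a: "q = p + v j" and b: "q + v m = p"
      have "Im (q + v m) = Im p" using b by (rule arg_cong)
      moreover have "Im q = Im p + Im (v j)" unfolding a by simp
      ultimately show False using * Im by linarith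
    qed
    show "q \<noteq> p + v i + v j"
    proof
      assume "q = p + v i + v j"
      then have "Im q = Im p + Im (v i) + Im (v j)" by simp
      moreover have "Im (q + v m) \<in> Im ` {p, p + v i, p + v j, p + v i + v j}" using q(2) by (rule imageI)
      then have "Im (q + v m) \<in> {Im p, Im p + Im (v i), Im p + Im (v j), Im p + Im (v i) + Im (v j)}"
        by (simp only: image_insert image_empty plus_complex.sel)
      ultimately show False using * Im by (auto simp del: cis.sel plus_complex.sel)
    qed
    show "v m \<noteq> 0" by simp
  qed
  consider "q = p" | "q = p + v i" | "q = p + v j" using q(1) up(3) by blast
  then have "(q = p \<and> v m = v i) \<or> (q = p + v j \<and> v m = v i) \<or> (q = p \<and> v m = v j) \<or> (q = p + v i \<and> v m = v j)"
  proof cases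
    case 1
    then have "p + v m = p + v i \<or> p + v m = p + v j" using q(2) d1 up(4) by (metis add_cancel_left_right insertE singletonD)
    then show ?thesis using 1 by (simp only: add_left_cancel) blast
  next
    case 2
    then have "q + v m = q \<or> q + v m = q + v j" using q(2) d2 up(1) by blast
    then show ?thesis using 2 up(4) by (simp only: add_left_cancel add_cancel_left_right) blast
  next
    case 3
    then have "q + v m = q \<or> q + v m = q + v i" using q(2) d3 up(2)
      by (metis add.assoc add.commute insertE singletonD)
    then show ?thesis using 3 up(4) by (simp only: add_left_cancel add_cancel_left_right) blast
  qed
  then show ?thesis using v_inj[OF m] ij by blast
qed

lemma rhombus_labels_unique:
  assumes "i \<in> {1..n}" "j \<in> {1..n}" "i \<noteq> j" "i' \<in> {1..n}" "j' \<in> {1..n}" "i' \<noteq> j'"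
    and "R p i j = R q i' j'"
  shows "{i, j} = {i', j'}"
proof -
  have "closed_segment q (q + v i') face_of R p i j" "closed_segment q (q + v j') face_of R p i j"
    using rhombus_side_face(1)[of i' j' q] rhombus_side_face(1)[of j' i' q] assms rhombus_commute by auto
  then show ?thesis
    using rhombus_face_unit_segment[OF assms(1-3), of i' q p] rhombus_face_unit_segment[OF assms(1-3), of j' q p] assms by auto
qed

text \<open>\<open>q\<close> is the corner between the two right-hand sides, with coordinates 1 and
  0. A short step to the left lowers the first and raises the second, which leads into the
  interior.\<close>

lemma rhombus_right_corner:
  assumes "i \<in> {1..n}" "j \<in> {1..n}" "j < i"
  obtains e where "e > 0" "\<And>r. 0 < r \<Longrightarrow> r \<le> e \<Longrightarrow> q - of_real r \<in> interior (R (q - v i) i j)"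
proof -
  obtain A B where AB: "A > 0" "B > 0" "\<And>r. of_real r = (r * A) *\<^sub>R v i - (r * B) *\<^sub>R v j"
    using unit_right[OF assms] by metis
  \<comment> \<open>With this bound \<open>r * A\<close> and \<open>r * B\<close> add up to at most
    1/2, so both coordinates stay strictly between 0 and 1.\<close>
  define e where "e = 1 / (2 * (A + B))"
  have "q - of_real r \<in> interior (R (q - v i) i j)" if r: "0 < r" "r \<le> e" for r
  proof -
    have "r * (A + B) \<le> e * (A + B)" using r AB by (intro mult_right_mono) auto
    also have "\<dots> = 1/2" using AB by (simp add: e_def)
    finally have "r * A + r * B < 1" by (simp add: algebra_simps)
    moreover have p: "r * A > 0" "r * B > 0" using r AB by auto
    ultimately have "r * A < 1" "r * B < 1" by linarith+
    then have "q - v i + (1 - r * A) *\<^sub>R v i + (r * B) *\<^sub>R v j \<in> interior (R (q - v i) i j)"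
      using p assms by (intro interior_rhombus) auto
    moreover have "q - v i + (1 - r * A) *\<^sub>R v i + (r * B) *\<^sub>R v j = q - of_real r"
      unfolding AB(3) by (simp add: algebra_simps)
    ultimately show ?thesis by simp
  qed
  moreover have "e > 0" using AB by (simp add: e_def)
  ultimately show ?thesis using that by blast
qed

end

subsection \<open>Boundary paths\<close>

context elnitsky
begin

definition trail :: "(nat \<Rightarrow> nat) \<Rightarrow> complex set" where
  "trail u = (\<Union>k\<in>{1..n}. E u k)"

text \<open>Horizontal shifts suffice because a path of descending edges has one point at each of
  its heights. The path itself belongs to both of its sides (\<open>r = 0\<close>), while points
  above or below the whole path belong to neither.\<close>

definition right_of :: "(nat \<Rightarrow> nat) \<Rightarrow> complex set" where
  "right_of u = {z. \<exists>r\<ge>0. z - of_real r \<in> trail u}"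

definition left_of :: "(nat \<Rightarrow> nat) \<Rightarrow> complex set" where
  "left_of u = {z. \<exists>r\<ge>0. z + of_real r \<in> trail u}"

lemma right_ofI: "r \<ge> 0 \<Longrightarrow> z - of_real r \<in> trail u \<Longrightarrow> z \<in> right_of u"
  and left_ofI: "r \<ge> 0 \<Longrightarrow> z + of_real r \<in> trail u \<Longrightarrow> z \<in> left_of u"
  unfolding right_of_def left_of_def by auto

lemma P_0: "P u 0 = 0"
  by (simp add: path_vertex_def)

lemma P_step: "k \<ge> 1 \<Longrightarrow> P u k = P u (k - 1) + v (u k)"
  unfolding path_vertex_def by (cases k) auto

lemma mem_edge: "k \<ge> 1 \<Longrightarrow> z \<in> E u k \<longleftrightarrow> (\<exists>s. 0 \<le> s \<and> s \<le> 1 \<and> z = P u (k - 1) + s *\<^sub>R v (u k))"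
  unfolding path_edge_def in_segment by (auto simp: P_step algebra_simps)

lemma mem_trail: "z \<in> trail u \<longleftrightarrow>
  (\<exists>k s. k \<in> {1..n} \<and> 0 \<le> s \<and> s \<le> 1 \<and> z = P u (k - 1) + s *\<^sub>R v (u k))"
  unfolding trail_def using mem_edge by fastforce

lemma edge_subset_trail: "k \<in> {1..n} \<Longrightarrow> E u k \<subseteq> trail u"
  unfolding trail_def by auto

lemma P_in_edge: "P u (k - 1) \<in> E u k" "P u k \<in> E u k"
  unfolding path_edge_def by auto

lemma P_in_trail: assumes "k \<le> n" shows "P u k \<in> trail u"
proof (cases "k = 0")
  case True
  then show ?thesis using edge_subset_trail[of 1 u] P_in_edge(1)[of u 1] n_ge_2 by auto
next
  case False
  then show ?thesis using edge_subset_trail[of k u] P_in_edge(2)[of u k] assms by auto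
qed

lemma compact_trail: "compact (trail u)"
  unfolding trail_def path_edge_def by (intro compact_UN) auto

lemma perm_in: "u permutes {1..n} \<Longrightarrow> k \<in> {1..n} \<Longrightarrow> u k \<in> {1..n}"
  using permutes_in_image by metis

lemma Im_v_perm: "u permutes {1..n} \<Longrightarrow> k \<in> {1..n} \<Longrightarrow> Im (v (u k)) < 0"
  by (rule Im_v[OF perm_in])

lemma Im_P_less:
  assumes "u permutes {1..n}" "j < k" "k \<le> n" shows "Im (P u k) < Im (P u j)"
  using assms(2,3)
proof (induction k)
  case (Suc k)
  have "Im (P u (Suc k)) < Im (P u k)"
    using P_step[of "Suc k" u] Im_v_perm[OF assms(1), of "Suc k"] Suc.prems by simp
  then show ?case using Suc by (cases "j = k") auto
qed simp

lemma Im_P_le: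
  assumes "u permutes {1..n}" "j \<le> k" "k \<le> n" shows "Im (P u k) \<le> Im (P u j)"
  using Im_P_less[OF assms(1), of j k] assms by (cases "j = k") auto

lemma Im_edge:
  assumes "u permutes {1..n}" "k \<in> {1..n}" "z \<in> E u k"
  shows "Im (P u k) \<le> Im z" "Im z \<le> Im (P u (k - 1))"
    and "Im z = Im (P u k) \<Longrightarrow> z = P u k" "Im z = Im (P u (k - 1)) \<Longrightarrow> z = P u (k - 1)"
proof -
  obtain s where s: "0 \<le> s" "s \<le> 1" "z = P u (k - 1) + s *\<^sub>R v (u k)"
    using assms mem_edge[of k z u] by auto
  have neg: "Im (v (u k)) < 0" using Im_v_perm assms by blast
  have Pk: "P u k = P u (k - 1) + v (u k)" using P_step assms by auto
  have "1 * Im (v (u k)) \<le> s * Im (v (u k))" "s * Im (v (u k)) \<le> 0"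
    using neg s mult_right_mono_neg[of s 1 "Im (v (u k))"] by (auto simp: mult_nonneg_nonpos)
  then show "Im (P u k) \<le> Im z" "Im z \<le> Im (P u (k - 1))" using s(3) Pk by simp_all
  have "s = 1" if "Im z = Im (P u k)" using that neg s(3) Pk by auto
  then show "Im z = Im (P u k) \<Longrightarrow> z = P u k" using s(3) Pk by simp
  have "s = 0" if "Im z = Im (P u (k - 1))" using that neg s(3) Pk by auto
  then show "Im z = Im (P u (k - 1)) \<Longrightarrow> z = P u (k - 1)" using s(3) by simp
qed

text \<open>The path descends strictly. Two points of equal height on different edges can only be
  the common vertex of two consecutive edges.\<close>

lemma trail_same_height:
  assumes u: "u permutes {1..n}" and z: "z \<in> trail u" "z' \<in> trail u" and Im: "Im z = Im z'"
  shows "z = z'"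
proof -
  have *: "z = z'" if "j \<in> {1..n}" "k \<in> {1..n}" "j \<le> k" "z \<in> E u j" "z' \<in> E u k" "Im z = Im z'"
    for j k z z'
  proof (cases "j = k")
    case True
    have neg: "Im (v (u k)) < 0" using Im_v_perm u that by blast
    have "1 \<le> k" "z \<in> E u k" "z' \<in> E u k" using that True by auto
    then obtain s s' where "z = P u (k - 1) + s *\<^sub>R v (u k)" "z' = P u (k - 1) + s' *\<^sub>R v (u k)"
      using mem_edge by blast
    then show ?thesis using that(6) neg by auto
  next
    case False
    then have "Im (P u (k - 1)) \<le> Im (P u j)" using that by (intro Im_P_le[OF u]) auto
    then have "Im z = Im (P u j)" "Im z' = Im (P u (k - 1))" "Im (P u (k - 1)) = Im (P u j)"
      using Im_edge(1)[OF u that(1,4)] Im_edge(2)[OF u that(2,5)] that(6) by linarith+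
    moreover have "j = k - 1"
      using calculation(3) Im_P_less[OF u, of j "k - 1"] that False by force
    ultimately show ?thesis using Im_edge(3)[OF u that(1,4)] Im_edge(4)[OF u that(2,5)] by auto
  qed
  obtain j k where "j \<in> {1..n}" "k \<in> {1..n}" "z \<in> E u j" "z' \<in> E u k"
    using z unfolding trail_def by auto
  then show ?thesis using *[of j k z z'] *[of k j z' z] Im by (cases "j \<le> k") auto
qed

lemma trail_shift:
  assumes "u permutes {1..n}" "z + of_real a \<in> trail u" "z + of_real b \<in> trail u"
  shows "a = b"
  using trail_same_height[OF assms] by simp

lemma trail_shift_0:
  assumes "u permutes {1..n}" "z \<in> trail u" "z + of_real b \<in> trail u"
  shows "b = 0"
  using trail_shift[of u z 0 b] assms by simp

lemma trail_at_height:
  assumes u: "u permutes {1..n}" and h: "Im (P u n) \<le> h" "h \<le> 0"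
  obtains z where "z \<in> trail u" "Im z = h"
proof -
  \<comment> \<open>The first vertex not above \<open>h\<close>: the edge ending there crosses this
    height, and \<open>s\<close> below solves the linear equation on that edge.\<close>
  define k where "k = (LEAST k. Im (P u k) \<le> h)"
  have k: "Im (P u k) \<le> h" and kn: "k \<le> n"
    unfolding k_def using h(1) by (auto intro: LeastI Least_le)
  show ?thesis
  proof (cases "k = 0")
    case True
    then have "Im (P u 0) = h" using k h P_0 by auto
    then show ?thesis using that P_in_trail[of 0 u] by simp
  next
    case False
    then have "h < Im (P u (k - 1))" using not_less_Least[of "k - 1" "\<lambda>k. Im (P u k) \<le> h"] k_def
      by (metis diff_less less_numeral_extra(1) not_le_imp_less not_gr_zero)
    have kk: "k \<in> {1..n}" using False kn by auto
    define s where "s = (h - Im (P u (k - 1))) / Im (v (u k))"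
    have neg: "Im (v (u k)) < 0" using Im_v_perm u kk by blast
    have "P u k = P u (k - 1) + v (u k)" using P_step kk by auto
    then have "Im (P u (k - 1)) + Im (v (u k)) \<le> h" using k by simp
    then have "0 \<le> s" "s \<le> 1" using neg \<open>h < _\<close> unfolding s_def by (auto simp: field_simps divide_nonpos_neg simp del: cis.sel)
    moreover have "Im (P u (k - 1) + s *\<^sub>R v (u k)) = h" using neg by (simp add: s_def)
    ultimately show ?thesis using that[of "P u (k - 1) + s *\<^sub>R v (u k)"] kk mem_trail by auto
  qed
qed

lemma P_image_eq:
  assumes "u permutes {1..n}" "u' permutes {1..n}" "u ` {1..k} = u' ` {1..k}"
  shows "P u k = P u' k"
proof -
  have "inj_on u {1..k}" "inj_on u' {1..k}" using assms(1,2) permutes_inj_on by blast+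
  then have "P u k = (\<Sum>i\<in>u ` {1..k}. v i)" "P u' k = (\<Sum>i\<in>u' ` {1..k}. v i)"
    unfolding path_vertex_def by (auto simp: sum.reindex)
  then show ?thesis using assms(3) by simp
qed

lemma P_total: assumes "u permutes {1..n}" shows "P u n = P id n"
  using P_image_eq[OF assms permutes_id, of n] assms by (simp add: permutes_image)

section \<open>The zonotope spanned by the edge vectors\<close>

definition threshold :: "nat \<Rightarrow> real \<Rightarrow> nat \<Rightarrow> real" where
  "threshold k s j = (if j < k then 1 else if j = k then s else 0)"

lemma trail_point_sum:
  assumes "k \<in> {1..n}"
  shows "P u (k - 1) + s *\<^sub>R v (u k) = (\<Sum>j=1..n. threshold k s j *\<^sub>R v (u j))"
proof -
  have split: "{1..n} = {1..k-1} \<union> ({k} \<union> {k+1..n})" using assms by auto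
  have "(\<Sum>j=1..n. threshold k s j *\<^sub>R v (u j)) =
    (\<Sum>j=1..k-1. threshold k s j *\<^sub>R v (u j)) + (threshold k s k *\<^sub>R v (u k) +
     (\<Sum>j=k+1..n. threshold k s j *\<^sub>R v (u j)))"
    unfolding split by (subst sum.union_disjoint; (subst sum.union_disjoint)?) auto
  also have "(\<Sum>j=1..k-1. threshold k s j *\<^sub>R v (u j)) = P u (k - 1)"
    unfolding path_vertex_def by (rule sum.cong) (use assms in \<open>auto simp: threshold_def\<close>)
  also have "(\<Sum>j=k+1..n. threshold k s j *\<^sub>R v (u j)) = 0"
    by (rule sum.neutral) (auto simp: threshold_def)
  finally show ?thesis by (simp add: threshold_def)
qed

text \<open>
  A point of the left path maximises the linear functional \<open>\<lambda>z. wedge z (v m)\<close>, for \<open>m\<close> the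
  label of its edge, over the zonotope of all \<open>\<Sum>j. c j *\<^sub>R v j\<close> with coefficients in the unit
  interval, and every coefficient other than that of \<open>v m\<close> is determined by maximality.
\<close>

lemma left_path_extremal:
  assumes u: "u permutes {1..n}" and c: "\<And>j. j \<in> {1..n} \<Longrightarrow> 0 \<le> c j \<and> c j \<le> 1"
    and l: "(\<Sum>j=1..n. c j *\<^sub>R v (u j)) + of_real r \<in> trail id" and r: "r \<ge> 0"
  shows "r = 0" "\<exists>m\<in>{1..n}. \<forall>j\<in>{1..n}. (u j < m \<longrightarrow> c j = 1) \<and> (u j > m \<longrightarrow> c j = 0)"
proof -
  obtain m s where m: "m \<in> {1..n}" and s: "0 \<le> s" "s \<le> 1"
    and l': "(\<Sum>j=1..n. c j *\<^sub>R v (u j)) + of_real r = P id (m - 1) + s *\<^sub>R v (id m)"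
    using l unfolding mem_trail by auto
  \<comment> \<open>The contribution of each label to the difference of the two points under the
    functional. Every term is at most 0, since \<open>threshold\<close> is 1 where the wedge is
    positive and 0 where it is negative; the total \<open>- r * Im (v m)\<close> is at least 0.
    Hence everything vanishes.\<close>
  define f where "f j = (c j - threshold m s (u j)) * wedge (v (u j)) (v m)" for j
  have "(\<Sum>j=1..n. threshold m s j *\<^sub>R v (id j)) = (\<Sum>j=1..n. threshold m s (u j) *\<^sub>R v (u j))"
    using sum.permute[OF u, of "\<lambda>j. threshold m s j *\<^sub>R v j"] by (simp add: o_def)
  then have "(\<Sum>j=1..n. c j *\<^sub>R v (u j)) + of_real r = (\<Sum>j=1..n. threshold m s (u j) *\<^sub>R v (u j))"
    using l' trail_point_sum[OF m, of id s] by simp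
  then have "(\<Sum>j=1..n. (c j - threshold m s (u j)) *\<^sub>R v (u j)) = - of_real r"
    by (simp add: scaleR_diff_left sum_subtractf algebra_simps)
  from arg_cong[OF this, of "\<lambda>z. wedge z (v m)"] have sumf: "(\<Sum>j=1..n. f j) = - r * Im (v m)"
    by (simp add: wedge_sum_left wedge_simps f_def) (simp add: wedge_def)
  have less: "wedge (v (u j)) (v m) > 0" if "j \<in> {1..n}" "u j < m" for j
    using wedge_v[of "u j" m] m perm_in[OF u that(1)] that by blast
  have gt: "wedge (v (u j)) (v m) < 0" if "j \<in> {1..n}" "u j > m" for j
    using wedge_v[of m "u j"] m perm_in[OF u that(1)] that wedge_commute[of "v m"] by force
  have f_le: "f j \<le> 0" if j: "j \<in> {1..n}" for j
  proof (cases "u j" m rule: linorder_cases)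
    case less
    then show ?thesis using c[OF j] \<open>\<And>j. j \<in> {1..n} \<Longrightarrow> u j < m \<Longrightarrow> _\<close>[OF j less]
      by (simp add: f_def threshold_def mult_nonpos_nonneg)
  next
    case equal
    then show ?thesis by (simp add: f_def wedge_self)
  next
    case greater
    then show ?thesis using c[OF j] gt[OF j greater]
      by (simp add: f_def threshold_def mult_nonneg_nonpos)
  qed
  then have "(\<Sum>j=1..n. f j) \<le> 0" by (intro sum_nonpos)
  moreover have "- r * Im (v m) \<ge> 0" using Im_v[OF m] r by (simp add: mult_nonneg_nonpos)
  ultimately have zero: "- r * Im (v m) = 0" and "(\<Sum>j=1..n. f j) = 0" using sumf by linarith+
  then have f0: "f j = 0" if "j \<in> {1..n}" for j
    using sum_nonneg_eq_0_iff[of "{1..n}" "\<lambda>j. - f j"] f_le that by (simp add: sum_negf)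
  show "r = 0" using zero Im_v[OF m] by auto
  have "(u j < m \<longrightarrow> c j = 1) \<and> (u j > m \<longrightarrow> c j = 0)" if j: "j \<in> {1..n}" for j
    using f0[OF j] less[OF j] gt[OF j] unfolding f_def threshold_def by force
  then show "\<exists>m\<in>{1..n}. \<forall>j\<in>{1..n}. (u j < m \<longrightarrow> c j = 1) \<and> (u j > m \<longrightarrow> c j = 0)"
    using m by blast
qed

text \<open>The height of the point lies between those of the bottom and top vertices, so the left
  boundary has a point at the same height. That point cannot lie strictly to the right, by the
  extremality of the left boundary.\<close>

lemma zonotope_right_of:
  assumes u: "u permutes {1..n}" and c: "\<And>j. j \<in> {1..n} \<Longrightarrow> 0 \<le> c j \<and> c j \<le> 1"
  shows "(\<Sum>j=1..n. c j *\<^sub>R v (u j)) \<in> right_of id"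
proof -
  let ?z = "\<Sum>j=1..n. c j *\<^sub>R v (u j)"
  have Imz: "Im ?z = (\<Sum>j=1..n. c j * Im (v (u j)))" by (simp add: Im_sum)
  have neg: "Im (v (u j)) \<le> 0" if "j \<in> {1..n}" for j using Im_v_perm[OF u that] by simp
  have "Im ?z \<le> 0" unfolding Imz 
  proof (rule sum_nonpos)
    fix j assume j: "j \<in> {1..n}"
    show "c j * Im (v (u j)) \<le> 0" using c[OF j] neg[OF j] by (intro mult_nonneg_nonpos) auto
  qed
  moreover have "Im (P id n) \<le> Im ?z"
    unfolding P_total[OF u, symmetric] Imz unfolding path_vertex_def Im_sum
  proof (rule sum_mono)
    fix j assume j: "j \<in> {1..n}"
    show "Im (v (u j)) \<le> c j * Im (v (u j))"
      using mult_right_mono_neg[of "c j" 1 "Im (v (u j))"] c[OF j] neg[OF j] by (simp del: cis.sel)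
  qed
  ultimately obtain l where l: "l \<in> trail id" "Im l = Im ?z"
    using trail_at_height[OF permutes_id] by metis
  define r where "r = Re l - Re ?z"
  have lr: "?z + of_real r = l" using l by (simp add: complex_eq_iff r_def)
  have "r \<le> 0"
  proof (rule ccontr)
    assume "\<not> r \<le> 0"
    moreover have "?z + of_real r \<in> trail id" unfolding lr by (rule l(1))
    ultimately show False using left_path_extremal(1)[OF u c, where r = r] by force
  qed
  moreover have "?z - of_real (- r) \<in> trail id" using lr l(1) by simp
  ultimately show ?thesis using right_ofI[of "- r"] by simp
qed

lemma trail_subset_right_of:
  assumes u: "u permutes {1..n}" shows "trail u \<subseteq> right_of id"
proof
  fix z assume "z \<in> trail u"
  then obtain k s where "k \<in> {1..n}" "0 \<le> s" "s \<le> 1" "z = P u (k - 1) + s *\<^sub>R v (u k)"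
    unfolding mem_trail by auto
  then show "z \<in> right_of id"
    using zonotope_right_of[OF u, of "threshold k s"] trail_point_sum[of k u s] by (auto simp: threshold_def)
qed

lemma trail_subset_left_of: "trail u \<subseteq> left_of u"
  unfolding left_of_def by (auto intro!: exI[of _ 0])

lemma right_of_not_left:
  assumes "z \<in> right_of id" "z + of_real r \<in> trail id" "r \<ge> 0" shows "r = 0"
proof -
  obtain a where "a \<ge> 0" "z + of_real (- a) \<in> trail id" using assms(1) by (auto simp: right_of_def)
  then show ?thesis using trail_shift[OF permutes_id, of z "- a" r] assms by simp
qed

end

subsection \<open>Elnitsky's polygon\<close>

context elnitsky
begin

text \<open>Each side is the Minkowski sum of the compact path and a closed horizontal ray.\<close>

lemma closed_right_of: "closed (right_of u)" and closed_left_of: "closed (left_of u)"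
proof -
  have cl: "closed {z. Im z = 0 \<and> 0 \<le> Re z}" "closed {z. Im z = 0 \<and> Re z \<le> 0}"
    by (intro closed_Collect_conj closed_Collect_eq closed_Collect_le continuous_intros)+
  have "right_of u = (\<Union>x\<in>trail u. \<Union>y\<in>{z. Im z = 0 \<and> 0 \<le> Re z}. {x + y})"
  proof (intro set_eqI iffI)
    fix z assume "z \<in> right_of u"
    then obtain r where "r \<ge> 0" "z - of_real r \<in> trail u" by (auto simp: right_of_def)
    then show "z \<in> (\<Union>x\<in>trail u. \<Union>y\<in>{z. Im z = 0 \<and> 0 \<le> Re z}. {x + y})"
      by (intro UN_I[of "z - of_real r"] UN_I[of "of_real r"]) auto
  next
    fix z assume "z \<in> (\<Union>x\<in>trail u. \<Union>y\<in>{z. Im z = 0 \<and> 0 \<le> Re z}. {x + y})"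
    then obtain x y where xy: "x \<in> trail u" "Im y = 0" "0 \<le> Re y" "z = x + y" by auto
    then have "z - of_real (Re y) = x" by (simp add: complex_eq_iff)
    then show "z \<in> right_of u" using xy by (intro right_ofI[of "Re y"]) auto
  qed
  then show "closed (right_of u)" using compact_closed_sums[OF compact_trail cl(1)] by (simp only:)
  have "left_of u = (\<Union>x\<in>trail u. \<Union>y\<in>{z. Im z = 0 \<and> Re z \<le> 0}. {x + y})"
  proof (intro set_eqI iffI)
    fix z assume "z \<in> left_of u"
    then obtain r where "r \<ge> 0" "z + of_real r \<in> trail u" by (auto simp: left_of_def)
    then show "z \<in> (\<Union>x\<in>trail u. \<Union>y\<in>{z. Im z = 0 \<and> Re z \<le> 0}. {x + y})"
      by (intro UN_I[of "z + of_real r"] UN_I[of "- of_real r"]) auto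
  next
    fix z assume "z \<in> (\<Union>x\<in>trail u. \<Union>y\<in>{z. Im z = 0 \<and> Re z \<le> 0}. {x + y})"
    then obtain x y where xy: "x \<in> trail u" "Im y = 0" "Re y \<le> 0" "z = x + y" by auto
    then have "z + of_real (- Re y) = x" by (simp add: complex_eq_iff)
    then show "z \<in> left_of u" using xy by (intro left_ofI[of "- Re y"]) auto
  qed
  then show "closed (left_of u)" using compact_closed_sums[OF compact_trail cl(2)] by (simp only:)
qed

lemma Im_trail:
  assumes u: "u permutes {1..n}" and z: "z \<in> trail u"
  shows "Im (P id n) \<le> Im z" "Im z \<le> 0"
proof -
  obtain k where k: "k \<in> {1..n}" "z \<in> E u k" using z by (auto simp: trail_def)
  have "Im (P u n) \<le> Im (P u k)" "Im (P u (k - 1)) \<le> Im (P u 0)" using k by (auto intro!: Im_P_le[OF u])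
  then show "Im (P id n) \<le> Im z" "Im z \<le> 0" using Im_edge(1,2)[OF u k] P_total[OF u] P_0[of u] by auto
qed

lemma horizontal_trail:
  assumes u: "u permutes {1..n}" and h: "Im (P id n) \<le> Im z" "Im z \<le> 0"
  obtains r where "z + of_real r \<in> trail u"
proof -
  obtain y where y: "y \<in> trail u" "Im y = Im z"
    using trail_at_height[OF u] h P_total[OF u] by metis
  then have "z + of_real (Re y - Re z) = y" by (simp add: complex_eq_iff)
  then show ?thesis using that y by metis
qed

lemma left_trail_subset_left_of:
  assumes u: "u permutes {1..n}" shows "trail id \<subseteq> left_of u"
proof
  fix l assume l: "l \<in> trail id"
  obtain c where c: "l + of_real c \<in> trail u"
    using horizontal_trail[OF u] Im_trail[OF permutes_id l] by metis
  then obtain a where a: "a \<ge> 0" "l + of_real c - of_real a \<in> trail id"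
    using trail_subset_right_of[OF u] unfolding right_of_def by blast
  then have "l + of_real (c - a) \<in> trail id" by (simp add: algebra_simps)
  then have "c - a = 0" using trail_shift_0[OF permutes_id l] by blast
  then show "l \<in> left_of u" using c a by (intro left_ofI[of c]) auto
qed

text \<open>At the heights of the top and bottom vertices both paths consist of one common point, so
  the region has no further points there. At all other points off the boundary the horizontal
  distances to both paths are positive.\<close>

lemma mem_boundary_or_strict:
  assumes w: "w permutes {1..n}" and z: "z \<in> right_of id" "z \<in> left_of w" "z \<notin> trail id" "z \<notin> trail w"
  shows "Im (P id n) < Im z" "Im z < 0" "z \<notin> left_of id" "z \<notin> right_of w"
proof -
  obtain a where a: "a \<ge> 0" "z - of_real a \<in> trail id" using z by (auto simp: right_of_def)
  obtain b where b: "b \<ge> 0" "z + of_real b \<in> trail w" using z by (auto simp: left_of_def)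
  have a0: "a > 0" using a z(3) by (cases "a = 0") auto
  have b0: "b > 0" using b z(4) by (cases "b = 0") auto
  have False if p: "p \<in> trail id" "p \<in> trail w" "Im z = Im p" for p
  proof -
    have "z - of_real a = p" by (rule trail_same_height[OF permutes_id]) (use a p in auto)
    moreover have "z + of_real b = p" by (rule trail_same_height[OF w]) (use b p in auto)
    ultimately have "z - of_real a = z + of_real b" by simp
    then have "Re (z - of_real a) = Re (z + of_real b)" by (rule arg_cong)
    then show False using a0 b0 by simp
  qed
  from this[of 0] this[of "P id n"] have "Im z \<noteq> 0" "Im z \<noteq> Im (P id n)"
    using P_in_trail[of 0] P_in_trail[of n] P_0 P_total[OF w] by (metis le0 zero_complex.sel(2), metis order_refl)
  then show "Im (P id n) < Im z" "Im z < 0" using Im_trail[OF w b(2)] by auto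
  show "z \<notin> left_of id"
  proof
    assume "z \<in> left_of id"
    then obtain r where "r \<ge> 0" "z + of_real r \<in> trail id" by (auto simp: left_of_def)
    then show False using trail_shift[OF permutes_id, of z r "- a"] a a0 by simp
  qed
  show "z \<notin> right_of w"
  proof
    assume "z \<in> right_of w"
    then obtain r where "r \<ge> 0" "z + of_real (- r) \<in> trail w" by (auto simp: right_of_def)
    then show False using trail_shift[OF w, of z "- r" b] b b0 by simp
  qed
qed

lemma bounded_between: "bounded (right_of id \<inter> left_of w)"
proof -
  obtain M where M: "\<And>z. z \<in> trail id \<union> trail w \<Longrightarrow> norm z \<le> M"
    using compact_imp_bounded[OF compact_Un[OF compact_trail compact_trail], of id w]
    unfolding bounded_iff by metis
  have "norm z \<le> M + M" if z: "z \<in> right_of id \<inter> left_of w" for z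
  proof -
    obtain a where a: "a \<ge> 0" "z - of_real a \<in> trail id" using z by (auto simp: right_of_def)
    obtain b where b: "b \<ge> 0" "z + of_real b \<in> trail w" using z by (auto simp: left_of_def)
    have "\<bar>Re (z - of_real a)\<bar> \<le> M" "\<bar>Im (z - of_real a)\<bar> \<le> M" "\<bar>Re (z + of_real b)\<bar> \<le> M"
      using M a b abs_Re_le_cmod abs_Im_le_cmod by (meson UnI1 UnI2 order_trans)+
    then have "\<bar>Re z\<bar> + \<bar>Im z\<bar> \<le> M + M" using a b by auto
    then show ?thesis using cmod_le[of z] by linarith
  qed
  then show ?thesis unfolding bounded_iff by blast
qed

text \<open>The complement of the boundary splits into two disjoint open sets: the strict interior
  \<open>D\<close> and the complement of \<open>?X\<close>. A component meeting \<open>D\<close>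
  therefore stays in the bounded set \<open>?X\<close>. A point outside \<open>?X\<close> escapes to
  infinity along a horizontal ray, to the left or to the right, without crossing the
  boundary.\<close>

lemma elnitsky_polygon_eq:
  assumes w: "w permutes {1..n}"
  shows "elnitsky_polygon n \<theta> w = right_of id \<inter> left_of w"
proof -
  let ?X = "right_of id \<inter> left_of w"
  define B where "B = trail id \<union> trail w"
  define D where "D = {z. Im (P id n) < Im z} \<inter> {z. Im z < 0} - left_of id - right_of w"
  have pb: "polygon_boundary n \<theta> w = B" by (simp add: polygon_boundary_def B_def trail_def)
  have "open D" unfolding D_def
    by (intro open_Diff open_Int closed_left_of closed_right_of open_Collect_less continuous_intros)
  have "closed ?X" by (intro closed_Int closed_left_of closed_right_of)
  have BX: "B \<subseteq> ?X"
    using trail_subset_right_of[OF permutes_id] trail_subset_right_of[OF w] trail_subset_left_of[of w]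
      left_trail_subset_left_of[OF w] by (auto simp: B_def)
  have DX: "D \<subseteq> ?X"
  proof
    fix z assume z: "z \<in> D"
    then have h: "Im (P id n) \<le> Im z" "Im z \<le> 0" by (auto simp: D_def)
    obtain c where c: "z + of_real c \<in> trail id" using horizontal_trail[OF permutes_id h] by metis
    obtain d where d: "z + of_real d \<in> trail w" using horizontal_trail[OF w h] by metis
    have "c \<le> 0" using left_ofI[of c z id] c z by (force simp: D_def)
    then have "z \<in> right_of id" using right_ofI[of "- c" z id] c by simp
    have "d \<ge> 0" using right_ofI[of "- d" z w] d z by (force simp: D_def)
    then have "z \<in> left_of w" using left_ofI[of d z w] d by simp
    show "z \<in> ?X" using \<open>z \<in> right_of id\<close> \<open>z \<in> left_of w\<close> by blast
  qed
  have DB: "D \<inter> B = {}"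
  proof -
    have "trail id \<subseteq> left_of id" by (rule trail_subset_left_of)
    moreover have "trail w \<subseteq> right_of w" by (auto intro!: right_ofI[of 0])
    ultimately show ?thesis by (auto simp: D_def B_def)
  qed
  have XD: "z \<in> D" if "z \<in> ?X" "z \<notin> B" for z
    using mem_boundary_or_strict[OF w, of z] that by (auto simp: D_def B_def)
  have "inside B = D"
  proof (intro set_eqI iffI)
    fix z assume z: "z \<in> D"
    let ?C = "connected_component_set (- B) z"
    have "?C \<inter> D \<noteq> {}" using z DB by (metis ComplI IntI connected_component_refl disjoint_iff empty_iff mem_Collect_eq)
    moreover have "?C \<subseteq> D \<union> - ?X" using connected_component_subset[of "- B" z] XD by blast
    moreover have "D \<inter> - ?X \<inter> ?C = {}" using DX by blast
    ultimately have "- ?X \<inter> ?C = {}"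
      using connectedD[OF connected_connected_component, of D "- ?X" "- B" z] \<open>open D\<close> \<open>closed ?X\<close>
      by (metis Int_commute open_Compl)
    then have "?C \<subseteq> ?X" by blast
    then have "bounded ?C" using bounded_between bounded_subset by blast
    then show "z \<in> inside B" using z DB by (auto simp: inside_def)
  next
    fix z assume z: "z \<in> inside B"
    then have zB: "z \<notin> B" and bd: "bounded (connected_component_set (- B) z)" by (auto simp: inside_def)
    have unb: False if s: "s = 1 \<or> s = - 1" and ray: "\<And>t. t \<ge> 0 \<Longrightarrow> z + of_real (s * t) \<notin> B" for s :: real
    proof -
      let ?R = "(\<lambda>t. z + of_real (s * t)) ` {0..}"
      have "connected ?R" by (intro connected_continuous_image continuous_intros) auto
      moreover have "z \<in> ?R" by (auto intro!: image_eqI[of _ _ 0])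
      moreover have "?R \<subseteq> - B" using ray by auto
      ultimately have "?R \<subseteq> connected_component_set (- B) z" by (intro connected_component_maximal)
      then have "bounded ?R" using bd bounded_subset by blast
      then obtain M where M: "\<And>t. t \<ge> 0 \<Longrightarrow> norm (z + of_real (s * t)) \<le> M" unfolding bounded_iff by auto
      \<comment> \<open>Large enough that \<open>t - norm z\<close> exceeds the assumed bound
        \<open>M\<close>.\<close>
      define t where "t = \<bar>M\<bar> + norm z + 1"
      have "t \<ge> 0" by (simp add: t_def)
      then have "t = norm (of_real (s * t) :: complex)" unfolding norm_of_real using s by auto
      also have "\<dots> \<le> norm (z + of_real (s * t)) + norm z"
        using norm_triangle_ineq4[of "z + of_real (s * t)" z] by simp
      also have "\<dots> \<le> M + norm z" using M[of t] by (simp add: t_def)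
      finally show False by (simp add: t_def)
    qed
    show "z \<in> D"
    proof (rule ccontr)
      assume "z \<notin> D"
      then consider "z \<notin> right_of id" | "z \<notin> left_of w" using XD zB by blast
      then show False
      proof cases
        case 1
        show False
        proof (rule unb[of "- 1"])
          fix t :: real assume t: "t \<ge> 0"
          show "z + of_real (- 1 * t) \<notin> B"
          proof
            assume "z + of_real (- 1 * t) \<in> B"
            then have "z - of_real t \<in> right_of id" using BX by auto
            then obtain a where "a \<ge> 0" "z - of_real t - of_real a \<in> trail id" by (auto simp: right_of_def)
            then show False using right_ofI[of "t + a" z id] t 1 by (simp add: algebra_simps)
          qed
        qed simp
      next
        case 2
        show False
        proof (rule unb[of 1])
          fix t :: real assume t: "t \<ge> 0"
          show "z + of_real (1 * t) \<notin> B"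
          proof
            assume "z + of_real (1 * t) \<in> B"
            then have "z + of_real t \<in> left_of w" using BX by auto
            then obtain a where "a \<ge> 0" "z + of_real t + of_real a \<in> trail w" by (auto simp: left_of_def)
            then show False using left_ofI[of "t + a" z w] t 2 by (simp add: algebra_simps)
          qed
        qed simp
      qed
    qed
  qed
  then show ?thesis unfolding elnitsky_polygon_def pb using BX DX XD by blast
qed

end

subsection \<open>Exchanging two consecutive edges\<close>

text \<open>The finitely many closed tiles that miss \<open>z\<close> stay at a positive distance
  from it, so a point close enough to \<open>z\<close> can only be covered by a tile that contains
  \<open>z\<close>.\<close>

lemma approached_tile:
  fixes z d :: complex
  assumes "finite T" "\<And>t. t \<in> T \<Longrightarrow> closed t" "b > 0"
    and "\<And>e. 0 < e \<Longrightarrow> e \<le> b \<Longrightarrow> z + of_real e * d \<in> \<Union>T"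
  obtains t e where "t \<in> T" "0 < e" "e \<le> b" "z \<in> t" "z + of_real e * d \<in> t"
proof -
  let ?C = "\<Union>{t \<in> T. z \<notin> t}"
  have "open (- ?C)" using assms(1,2) by (intro open_Compl closed_Union) auto
  then obtain \<epsilon> where \<epsilon>: "\<epsilon> > 0" "ball z \<epsilon> \<subseteq> - ?C" by (rule openE) auto
  \<comment> \<open>Keeps \<open>e * norm d\<close> below the radius; the summand 1 avoids division
    by zero when \<open>d\<close> vanishes.\<close>
  define e where "e = min b (\<epsilon> / (2 * (norm d + 1)))"
  have nd: "norm d + 1 > 0" using norm_ge_zero[of d] by linarith
  then have e: "0 < e" "e \<le> b" "e \<le> \<epsilon> / (2 * (norm d + 1))" using assms(3) \<epsilon>(1) by (auto simp: e_def)
  have "e * norm d \<le> e * (norm d + 1)" using e by simp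
  also have "\<dots> \<le> \<epsilon> / (2 * (norm d + 1)) * (norm d + 1)" using e nd by (intro mult_right_mono) auto
  also have "\<dots> = \<epsilon> / 2" using nd by (simp add: divide_simps)
  also have "\<dots> < \<epsilon>" using \<epsilon>(1) by simp
  finally have "z + of_real e * d \<in> ball z \<epsilon>" using e by (simp add: dist_norm norm_mult)
  then have "z + of_real e * d \<notin> ?C" using \<epsilon> by blast
  moreover have "z + of_real e * d \<in> \<Union>T" using assms(4) e by blast
  ultimately show ?thesis using that e by blast
qed

context elnitsky
begin

text \<open>Half the boundary of the rhombus, from its top to its bottom vertex: the right half of
  \<open>R p i j\<close> if \<open>j < i\<close>, the left half if \<open>i < j\<close>. An exchange
  of two path edges replaces one half by the other.\<close>

definition bent :: "complex \<Rightarrow> nat \<Rightarrow> nat \<Rightarrow> complex set" where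
  "bent p i j = closed_segment p (p + v i) \<union> closed_segment (p + v i) (p + v i + v j)"

lemma mem_bent: "z \<in> bent p i j \<longleftrightarrow>
  (\<exists>a. 0 \<le> a \<and> a \<le> 1 \<and> (z = p + a *\<^sub>R v i + 0 *\<^sub>R v j \<or> z = p + 1 *\<^sub>R v i + a *\<^sub>R v j))"
  unfolding bent_def in_segment Un_iff by (auto simp: algebra_simps)

lemma bent_subset_rhombus: "bent p i j \<subseteq> R p i j"
  unfolding mem_bent mem_rhombus subset_iff by (metis order_refl zero_le_one)

text \<open>Moving right increases the coordinate of the larger label and decreases the other. The
  point leaves the rhombus when the first reaches 1 or the second reaches 0, and the smaller of
  these two times is \<open>r\<close>.\<close>

lemma rhombus_move_right:
  assumes ij: "i \<in> {1..n}" "j \<in> {1..n}" "j < i" and z: "z \<in> R p i j"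
  obtains r where "r \<ge> 0" "z + of_real r \<in> bent p i j"
proof -
  obtain a b where ab: "0 \<le> a" "a \<le> 1" "0 \<le> b" "b \<le> 1" "z = p + a *\<^sub>R v i + b *\<^sub>R v j"
    using z mem_rhombus by auto
  obtain A B where AB: "A > 0" "B > 0" "\<And>r. of_real r = (r * A) *\<^sub>R v i - (r * B) *\<^sub>R v j"
    using unit_right[OF ij] by metis
  have move: "z + of_real r = p + (a + r * A) *\<^sub>R v i + (b - r * B) *\<^sub>R v j" for r
    unfolding ab(5) AB(3) by (simp add: algebra_simps)
  show ?thesis
  proof (cases "(1 - a) / A \<le> b / B")
    case True
    define r where "r = (1 - a) / A"
    have rA: "a + r * A = 1" using AB by (simp add: r_def)
    have "r * B \<le> b" using True AB by (simp add: r_def field_simps)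
    moreover have "r \<ge> 0" using ab AB by (simp add: r_def)
    moreover have "b - r * B \<le> 1"
      using ab mult_nonneg_nonneg[OF calculation(2), of B] AB by linarith
    ultimately show ?thesis using move[of r] ab AB unfolding rA
      by (intro that[of r]) (auto simp: mem_bent intro!: exI[of _ "b - r * B"])
  next
    case False
    define r where "r = b / B"
    have rB: "b - r * B = 0" using AB by (simp add: r_def)
    have "r * A \<le> 1 - a" using False AB by (simp add: r_def field_simps)
    moreover have "r \<ge> 0" using ab AB by (simp add: r_def)
    moreover have "a - r * A \<le> 1"
      using ab mult_nonneg_nonneg[OF calculation(2), of A] AB by linarith
    ultimately show ?thesis using move[of r] ab AB unfolding rB
      by (intro that[of r]) (auto simp: mem_bent intro!: exI[of _ "a + r * A"])
  qed
qed

lemma rhombus_move_left: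
  assumes ij: "i \<in> {1..n}" "j \<in> {1..n}" "j < i" and z: "z \<in> R p i j"
  obtains r where "r \<ge> 0" "z - of_real r \<in> bent p j i"
proof -
  obtain a b where ab: "0 \<le> a" "a \<le> 1" "0 \<le> b" "b \<le> 1" "z = p + a *\<^sub>R v i + b *\<^sub>R v j"
    using z mem_rhombus by auto
  obtain A B where AB: "A > 0" "B > 0" "\<And>r. of_real r = (r * A) *\<^sub>R v i - (r * B) *\<^sub>R v j"
    using unit_right[OF ij] by metis
  have move: "z - of_real r = p + (b + r * B) *\<^sub>R v j + (a - r * A) *\<^sub>R v i" for r
    unfolding ab(5) AB(3) by (simp add: algebra_simps)
  show ?thesis
  proof (cases "(1 - b) / B \<le> a / A")
    case True
    define r where "r = (1 - b) / B"
    have rB: "b + r * B = 1" using AB by (simp add: r_def)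
    have "r * A \<le> a" using True AB by (simp add: r_def field_simps)
    moreover have "r \<ge> 0" using ab AB by (simp add: r_def)
    moreover have "a - r * A \<le> 1"
      using ab mult_nonneg_nonneg[OF calculation(2), of A] AB by linarith
    ultimately show ?thesis using move[of r] ab AB unfolding rB
      by (intro that[of r]) (auto simp: mem_bent intro!: exI[of _ "a - r * A"])
  next
    case False
    define r where "r = a / A"
    have rA: "a - r * A = 0" using AB by (simp add: r_def)
    have "r * B \<le> 1 - b" using False AB by (simp add: r_def field_simps)
    moreover have "r \<ge> 0" using ab AB by (simp add: r_def)
    moreover have "b - r * B \<le> 1"
      using ab mult_nonneg_nonneg[OF calculation(2), of B] AB by linarith
    ultimately show ?thesis using move[of r] ab AB unfolding rA
      by (intro that[of r]) (auto simp: mem_bent intro!: exI[of _ "b + r * B"])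
  qed
qed

definition swapped :: "(nat \<Rightarrow> nat) \<Rightarrow> nat \<Rightarrow> nat \<Rightarrow> nat" where
  "swapped u k = u \<circ> Transposition.transpose k (k + 1)"

lemma swapped_apply: "swapped u k k = u (k + 1)" "swapped u k (k + 1) = u k"
  "m \<noteq> k \<Longrightarrow> m \<noteq> k + 1 \<Longrightarrow> swapped u k m = u m"
  by (auto simp: swapped_def Transposition.transpose_def)

lemma swapped_permutes:
  assumes "u permutes {1..n}" "1 \<le> k" "k < n" shows "swapped u k permutes {1..n}"
  unfolding swapped_def by (intro permutes_compose permutes_swap_id) (use assms in auto)

lemma P_swapped: assumes "1 \<le> k"
  shows "m \<noteq> k \<Longrightarrow> P (swapped u k) m = P u m"
    and "P (swapped u k) k = P u (k - 1) + v (u (k + 1))"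
proof -
  have low: "P (swapped u k) m = P u m" if "m < k" for m
    unfolding path_vertex_def by (rule sum.cong) (use that in \<open>auto simp: swapped_apply(3)\<close>)
  show k: "P (swapped u k) k = P u (k - 1) + v (u (k + 1))"
    using P_step[of k "swapped u k"] low[of "k - 1"] assms swapped_apply(1) by simp
  have k1: "P (swapped u k) (k + 1) = P u (k + 1)"
    using P_step[of "k + 1" "swapped u k"] P_step[of "k + 1" u] P_step[of k u] k assms
    by (simp add: swapped_apply(2)[simplified] add.commute add.left_commute)
  have high: "P (swapped u k) (k + 1 + d) = P u (k + 1 + d)" for d
  proof (induction d)
    case (Suc d)
    then show ?case
      using P_step[of "k + 1 + Suc d" "swapped u k"] P_step[of "k + 1 + Suc d" u]
        swapped_apply(3)[of "k + 1 + Suc d" k u] by simp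
  qed (use k1 in simp)
  show "P (swapped u k) m = P u m" if "m \<noteq> k"
  proof (cases "m < k")
    case True
    then show ?thesis by (rule low)
  next
    case False
    then have "m = k + 1 + (m - (k + 1))" using that by linarith
    then show ?thesis using high by metis
  qed
qed

lemma E_swapped: assumes "1 \<le> k" "1 \<le> m"
  shows "m \<noteq> k \<Longrightarrow> m \<noteq> k + 1 \<Longrightarrow> E (swapped u k) m = E u m"
    and "E (swapped u k) k = closed_segment (P u (k - 1)) (P u (k - 1) + v (u (k + 1)))"
    and "E (swapped u k) (k + 1) =
      closed_segment (P u (k - 1) + v (u (k + 1))) (P u (k - 1) + v (u (k + 1)) + v (u k))"
proof -
  show "E (swapped u k) m = E u m" if "m \<noteq> k" "m \<noteq> k + 1"
  proof -
    have "m - 1 \<noteq> k" using that assms by linarith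
    then show ?thesis unfolding path_edge_def using that assms by (metis P_swapped(1))
  qed
  show "E (swapped u k) k = closed_segment (P u (k - 1)) (P u (k - 1) + v (u (k + 1)))"
    unfolding path_edge_def using assms P_swapped[of k] by simp
  have "P u (k + 1) = P u (k - 1) + v (u (k + 1)) + v (u k)"
    using P_step[of "k + 1" u] P_step[of k u] assms by simp
  then show "E (swapped u k) (k + 1) =
      closed_segment (P u (k - 1) + v (u (k + 1))) (P u (k - 1) + v (u (k + 1)) + v (u k))"
    unfolding path_edge_def using assms P_swapped[of k] by simp
qed

lemma E_pair: assumes "1 \<le> k"
  shows "E u k = closed_segment (P u (k - 1)) (P u (k - 1) + v (u k))"
    and "E u (k + 1) = closed_segment (P u (k - 1) + v (u k)) (P u (k - 1) + v (u k) + v (u (k + 1)))"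
  unfolding path_edge_def using P_step[of k u] P_step[of "k + 1" u] assms by simp_all

lemma trail_swapped:
  assumes "1 \<le> k" "k < n"
  obtains S where "trail u = S \<union> bent (P u (k - 1)) (u k) (u (k + 1))"
    "trail (swapped u k) = S \<union> bent (P u (k - 1)) (u (k + 1)) (u k)"
proof -
  have split: "trail t = (\<Union>m\<in>{1..n} - {k, k + 1}. E t m) \<union> (E t k \<union> E t (k + 1))" for t
  proof -
    have "{1..n} = {1..n} - {k, k + 1} \<union> {k, k + 1}" using assms by auto
    then have "trail t = (\<Union>m\<in>{1..n} - {k, k + 1} \<union> {k, k + 1}. E t m)" by (simp only: trail_def)
    then show ?thesis by (simp only: UN_Un UN_insert UN_empty Un_empty_right)
  qed
  have "(\<Union>m\<in>{1..n} - {k, k + 1}. E (swapped u k) m) = (\<Union>m\<in>{1..n} - {k, k + 1}. E u m)"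
  proof (rule SUP_cong)
    fix m assume "m \<in> {1..n} - {k, k + 1}"
    then show "E (swapped u k) m = E u m" by (intro E_swapped(1) assms(1)) auto
  qed simp
  then have "trail (swapped u k) = (\<Union>m\<in>{1..n} - {k, k + 1}. E u m) \<union> bent (P u (k - 1)) (u (k + 1)) (u k)"
    using split[of "swapped u k"] E_swapped(2,3)[OF assms(1,1), of u] by (simp only: bent_def)
  moreover have "trail u = (\<Union>m\<in>{1..n} - {k, k + 1}. E u m) \<union> bent (P u (k - 1)) (u k) (u (k + 1))"
    using split[of u] E_pair[OF assms(1), of u] by (simp only: bent_def)
  ultimately show ?thesis using that by blast
qed

text \<open>If the ray from \<open>z\<close> to the right hits the part common to both paths,
  nothing changes. Otherwise it hits the right half of the tile. The left half lies at some distance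
  \<open>r0\<close> to the left of the hit, and \<open>z\<close> is either at least that far away,
  hence left of the new path, or inside the tile.\<close>

lemma left_of_swapped:
  assumes u: "u permutes {1..n}" and k: "1 \<le> k" "k < n" and desc: "u (k + 1) < u k"
  shows "left_of u = left_of (swapped u k) \<union> R (P u (k - 1)) (u k) (u (k + 1))"
proof -
  let ?p = "P u (k - 1)" and ?i = "u k" and ?j = "u (k + 1)"
  have ij: "?i \<in> {1..n}" "?j \<in> {1..n}" "?j < ?i" using perm_in[OF u] k desc by auto
  obtain S where S: "trail u = S \<union> bent ?p ?i ?j" "trail (swapped u k) = S \<union> bent ?p ?j ?i"
    using trail_swapped[OF k] by metis
  have tile: "R ?p ?i ?j \<subseteq> left_of u"
  proof
    fix z assume "z \<in> R ?p ?i ?j"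
    then obtain r where "r \<ge> 0" "z + of_real r \<in> bent ?p ?i ?j" using rhombus_move_right[OF ij] by metis
    then show "z \<in> left_of u" using S by (intro left_ofI[of r]) auto
  qed
  show ?thesis
  proof (intro set_eqI iffI)
    fix z assume "z \<in> left_of u"
    then obtain r where r: "r \<ge> 0" "z + of_real r \<in> trail u" by (auto simp: left_of_def)
    show "z \<in> left_of (swapped u k) \<union> R ?p ?i ?j"
    proof (cases "z + of_real r \<in> S")
      case True
      then show ?thesis using r S left_ofI[of r z "swapped u k"] by blast
    next
      case False
      then have zr: "z + of_real r \<in> bent ?p ?i ?j" using r S by blast
      then obtain r0 where r0: "r0 \<ge> 0" "z + of_real r - of_real r0 \<in> bent ?p ?j ?i"
        using rhombus_move_left[OF ij] bent_subset_rhombus by blast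
      show ?thesis
      proof (cases "r0 \<le> r")
        case True
        moreover have "z + of_real (r - r0) \<in> trail (swapped u k)" using r0(2) S by (simp add: add_diff_eq)
        ultimately show ?thesis using left_ofI[of "r - r0" z "swapped u k"] by simp
      next
        case False
        have in_R: "z + of_real r \<in> R ?p ?i ?j" "z + of_real r - of_real r0 \<in> R ?p ?i ?j"
          using zr r0 bent_subset_rhombus rhombus_commute by blast+
        \<comment> \<open>Here \<open>z\<close> lies between the hit on the right half and the point
          of the left half at the same height; both belong to the convex tile.\<close>
        have "z = (1 - r / r0) *\<^sub>R (z + of_real r) + (r / r0) *\<^sub>R (z + of_real r - of_real r0)"
          using False r by (simp add: complex_eq_iff field_simps)
        moreover have "0 \<le> 1 - r / r0" "0 \<le> r / r0" using False r by auto
        ultimately have "z \<in> R ?p ?i ?j"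
          using convexD[OF convex_rhombus in_R, of "1 - r / r0" "r / r0"] by simp
        then show ?thesis by blast
      qed
    qed
  next
    fix z assume "z \<in> left_of (swapped u k) \<union> R ?p ?i ?j"
    then show "z \<in> left_of u"
    proof
      assume "z \<in> left_of (swapped u k)"
      then obtain r where r: "r \<ge> 0" "z + of_real r \<in> S \<union> bent ?p ?j ?i" using S by (auto simp: left_of_def)
      show ?thesis
      proof (cases "z + of_real r \<in> S")
        case True
        then show ?thesis using r S left_ofI[of r z u] by blast
      next
        case False
        then have "z + of_real r \<in> R ?p ?i ?j" using r bent_subset_rhombus rhombus_commute by blast
        then obtain r' where "r' \<ge> 0" "z + of_real r + of_real r' \<in> trail u"
          using tile by (auto simp: left_of_def)
        then show ?thesis using left_ofI[of "r + r'" z u] r by (simp add: add.assoc)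
      qed
    qed (use tile in blast)
  qed
qed

end

subsection \<open>Tiles along the boundary\<close>

lemma finite_if_unique:
  assumes "\<And>x y. x \<in> S \<Longrightarrow> y \<in> S \<Longrightarrow> x = y"
  shows "finite S"
proof (cases "S = {}")
  case False
  then obtain x where "x \<in> S" by blast
  then have "S = {x}" using assms by blast
  then show ?thesis by simp
qed simp

lemma interior_point_of_segment:
  fixes A x :: complex
  assumes "0 < s" "s < 1" "x \<noteq> 0"
  shows "A + s *\<^sub>R x \<in> rel_interior (closed_segment A (A + x))"
proof -
  have "A + s *\<^sub>R x = (1 - s) *\<^sub>R A + s *\<^sub>R (A + x)" by (simp add: algebra_simps)
  moreover have "A \<noteq> A + x" using assms(3) by simp
  ultimately have "A + s *\<^sub>R x \<in> open_segment A (A + x)" unfolding in_segment using assms(1,2) by blast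
  then show ?thesis using assms(3) by (simp add: rel_interior_closed_segment)
qed

locale elnitsky_tiling = elnitsky +
  fixes w :: "nat \<Rightarrow> nat" and T :: "complex set set"
  assumes w: "w permutes {1..n}"
    and T: "T \<in> rhombic_tilings n \<theta> w"
begin

lemma finite_T: "finite T"
  using T unfolding rhombic_tilings_def by blast

lemma tileE:
  assumes "t \<in> T"
  obtains p i j where "i \<in> {1..n}" "j \<in> {1..n}" "i \<noteq> j" "t = R p i j"
proof -
  have "\<forall>t\<in>T. \<exists>i\<in>{1..n}. \<exists>j\<in>{1..n}. i \<noteq> j \<and> has_labels \<theta> t i j"
    using T unfolding rhombic_tilings_def by simp
  then obtain i j where "i \<in> {1..n}" "j \<in> {1..n}" "i \<noteq> j" "has_labels \<theta> t i j"
    using assms by meson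
  then show ?thesis using that by (auto simp: has_labels_def)
qed

lemma closed_tile: "t \<in> T \<Longrightarrow> closed t" and convex_tile: "t \<in> T \<Longrightarrow> convex t"
  using closed_rhombus convex_rhombus by (metis tileE)+

lemma Union_T: "\<Union>T = right_of id \<inter> left_of w"
  using T elnitsky_polygon_eq[OF w] unfolding rhombic_tilings_def by simp

lemma tile_subset: "t \<in> T \<Longrightarrow> t \<subseteq> right_of id" "t \<in> T \<Longrightarrow> t \<subseteq> left_of w"
  using Union_T by blast+

lemma tile_face: "s \<in> T \<Longrightarrow> t \<in> T \<Longrightarrow> (s \<inter> t) face_of s" "s \<in> T \<Longrightarrow> t \<in> T \<Longrightarrow> (s \<inter> t) face_of t"
  using T unfolding rhombic_tilings_def by blast+

text \<open>A tile is the closure of its interior, so an open set that meets it also meets its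
  interior. Disjointness of interiors thus extends to one interior and one whole tile.\<close>

lemma tile_eqI:
  assumes "s \<in> T" "t \<in> T" "q \<in> interior s" "q \<in> t"
  shows "s = t"
proof (rule ccontr)
  assume "s \<noteq> t"
  then have "interior s \<inter> interior t = {}"
    using T assms unfolding rhombic_tilings_def pairwise_def by blast
  then have "interior s \<inter> closure (interior t) = {}"
    by (simp add: open_Int_closure_eq_empty)
  moreover have "closure (interior t) = t"
    using tileE[OF assms(2)] closure_interior_rhombus by metis
  ultimately show False using assms by blast
qed

text \<open>Points just left of \<open>q\<close> lie in the tile and hence in the polygon, whereas
  points just left of the left boundary do not.\<close>

lemma corner_not_on_left:
  assumes "i \<in> {1..n}" "j \<in> {1..n}" "j < i" "R (q - v i) i j \<in> T"
  shows "q \<notin> trail id"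
proof
  assume q: "q \<in> trail id"
  obtain e where e: "e > 0" "\<And>r. 0 < r \<Longrightarrow> r \<le> e \<Longrightarrow> q - of_real r \<in> interior (R (q - v i) i j)"
    using rhombus_right_corner[OF assms(1-3)] by metis
  then have "q - of_real e \<in> right_of id"
    using tile_subset(1)[OF assms(4)] interior_subset by (meson order_refl subsetD)
  then have "e = 0" using right_of_not_left[of "q - of_real e" e] q e by simp
  then show False using e by simp
qed

text \<open>Both tiles contain the points just left of their common right corner \<open>q\<close>.
  At a path vertex this identifies a tile extending below the edge above it with a tile extending
  above the edge below it.\<close>

lemma corner_tile_unique:
  assumes "i \<in> {1..n}" "j \<in> {1..n}" "j < i" "R (q - v i) i j \<in> T"
    and "i' \<in> {1..n}" "j' \<in> {1..n}" "j' < i'" "R (q - v i') i' j' \<in> T"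
  shows "i' = i" "j' = j"
proof -
  obtain e where e: "e > 0" "\<And>r. 0 < r \<Longrightarrow> r \<le> e \<Longrightarrow> q - of_real r \<in> interior (R (q - v i) i j)"
    using rhombus_right_corner[OF assms(1-3)] by metis
  obtain e' where e': "e' > 0" "\<And>r. 0 < r \<Longrightarrow> r \<le> e' \<Longrightarrow> q - of_real r \<in> interior (R (q - v i') i' j')"
    using rhombus_right_corner[OF assms(5-7)] by metis
  have "q - of_real (min e e') \<in> interior (R (q - v i) i j)" "q - of_real (min e e') \<in> R (q - v i') i' j'"
    using e e' interior_subset by (force, force)
  then have "R (q - v i) i j = R (q - v i') i' j'" using tile_eqI assms(4,8) by blast
  then have "{i, j} = {i', j'}" using rhombus_labels_unique assms by (metis nat_neq_iff)
  then show "i' = i" "j' = j" using assms(3,7) by (auto simp: doubleton_eq_iff)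
qed

lemma approach_from_left:
  assumes z: "z \<in> right_of id" "z \<in> left_of w" "z \<notin> trail id"
  obtains t e where "t \<in> T" "e > 0" "z \<in> t" "z - of_real e \<in> t"
proof -
  obtain a where a: "a \<ge> 0" "z - of_real a \<in> trail id" using z(1) by (auto simp: right_of_def)
  then have a0: "a > 0" using z(3) by (cases "a = 0") auto
  obtain b where b: "b \<ge> 0" "z + of_real b \<in> trail w" using z(2) by (auto simp: left_of_def)
  have cover: "z + of_real e * (- 1) \<in> \<Union>T" if e: "0 < e" "e \<le> a" for e
  proof -
    have "z - of_real e \<in> right_of id" using e a right_ofI[of "a - e" "z - of_real e" id] by simp
    moreover have "z - of_real e \<in> left_of w" using e b left_ofI[of "b + e" "z - of_real e" w] by simp
    ultimately show ?thesis unfolding Union_T by simp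
  qed
  show ?thesis
    using approached_tile[OF finite_T closed_tile a0 cover] that by (metis mult_minus1_right uminus_add_conv_diff add.commute)
qed

lemma approach_from_right:
  assumes z: "z \<in> right_of id" "z \<in> left_of w" "z \<notin> trail w"
  obtains t e where "t \<in> T" "e > 0" "z \<in> t" "z + of_real e \<in> t"
proof -
  obtain a where a: "a \<ge> 0" "z - of_real a \<in> trail id" using z(1) by (auto simp: right_of_def)
  obtain b where b: "b \<ge> 0" "z + of_real b \<in> trail w" using z(2) by (auto simp: left_of_def)
  then have b0: "b > 0" using z(3) by (cases "b = 0") auto
  have cover: "z + of_real e * 1 \<in> \<Union>T" if e: "0 < e" "e \<le> b" for e
  proof -
    have "z + of_real e \<in> right_of id" using e a right_ofI[of "a + e" "z + of_real e" id] by simp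
    moreover have "z + of_real e \<in> left_of w" using e b left_ofI[of "b - e" "z + of_real e" w] by simp
    ultimately show ?thesis unfolding Union_T by simp
  qed
  show ?thesis
    using approached_tile[OF finite_T closed_tile b0 cover] that by (metis mult.right_neutral)
qed

section \<open>Right boundary edges are sides of tiles\<close>

lemma right_of_right_trail:
  assumes "k \<in> {1..n}" "0 \<le> s" "s \<le> 1" "c > 0"
  shows "P w (k - 1) + s *\<^sub>R v (w k) + of_real c \<notin> left_of w"
proof
  let ?q = "P w (k - 1) + s *\<^sub>R v (w k)"
  assume "?q + of_real c \<in> left_of w"
  then obtain r where r: "r \<ge> 0" "?q + of_real c + of_real r \<in> trail w" by (auto simp: left_of_def)
  then have "?q + of_real (c + r) \<in> trail w" by (simp add: add.assoc)
  moreover have "?q \<in> trail w" using assms mem_trail by blast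
  ultimately have "c + r = 0" using trail_shift_0[OF w] by blast
  then show False using r assms by simp
qed

text \<open>
  A tile at a right edge cannot be shifted along the edge: the part of a shifted tile's
  side that protrudes from the edge is in contact with a tile on its other side, which by the
  edge-to-edge condition contains the whole side and hence reaches beyond the right boundary.
\<close>

lemma side_at_right_edge:
  assumes k: "k \<in> {1..n}" and s: "0 < s" "s < 1"
    and t: "t \<in> T" and side: "closed_segment A (A + v (w k)) face_of t"
    and \<alpha>: "0 < \<alpha>" "\<alpha> < 1" and Q: "P w (k - 1) + s *\<^sub>R v (w k) = A + \<alpha> *\<^sub>R v (w k)"
  shows "A = P w (k - 1)"
proof (rule ccontr)
  assume A: "A \<noteq> P w (k - 1)"
  let ?a = "w k" and ?p = "P w (k - 1)"
  have a: "?a \<in> {1..n}" using perm_in[OF w k] .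
  define \<sigma> where "\<sigma> = s - \<alpha>"
  have A': "A = ?p + \<sigma> *\<^sub>R v ?a" using Q by (simp add: \<sigma>_def algebra_simps)
  have \<sigma>: "\<sigma> \<noteq> 0" using A A' by auto
  have \<sigma>_bound: "-1 < \<sigma>" "\<sigma> < 1" using s \<alpha> by (auto simp: \<sigma>_def)
  \<comment> \<open>Parameters of the part of the shifted side beyond the edge: past the lower end
    if \<sigma> is positive, before the upper end otherwise.\<close>
  define I where "I = (if \<sigma> > 0 then {1 - \<sigma><..<1} else {0<..< - \<sigma>})"
  have I: "infinite I" "I \<subseteq> {0<..<1}" using \<sigma> \<sigma>_bound unfolding I_def by (auto simp: infinite_Ioo)
  have outside: "\<sigma> + \<tau> < 0 \<or> \<sigma> + \<tau> > 1" if "\<tau> \<in> I" for \<tau>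
    using that \<sigma> unfolding I_def by (auto split: if_splits)
  \<comment> \<open>Edges with another label cross the side in at most one point, and the edge
    \<open>k\<close> itself is avoided by the choice of \<open>I\<close>. So all but finitely many
    protruding points lie off the right boundary, where a tile on the right exists.\<close>
  have fin: "finite {\<tau> \<in> I. A + \<tau> *\<^sub>R v ?a \<in> E w m}" if m: "m \<in> {1..n}" for m
  proof (rule finite_if_unique)
    fix \<tau> \<tau>'
    assume "\<tau> \<in> {\<tau> \<in> I. A + \<tau> *\<^sub>R v ?a \<in> E w m}" "\<tau>' \<in> {\<tau> \<in> I. A + \<tau> *\<^sub>R v ?a \<in> E w m}"
    then have \<tau>: "\<tau> \<in> I" "A + \<tau> *\<^sub>R v ?a \<in> E w m" and \<tau>': "\<tau>' \<in> I" "A + \<tau>' *\<^sub>R v ?a \<in> E w m"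
      by blast+
    show "\<tau> = \<tau>'"
    proof -
      have m1: "1 \<le> m" using m by simp
      obtain x where x: "0 \<le> x" "x \<le> 1" "A + \<tau> *\<^sub>R v ?a = P w (m - 1) + x *\<^sub>R v (w m)"
        using \<tau>(2) unfolding mem_edge[OF m1] by blast
      obtain y where y: "A + \<tau>' *\<^sub>R v ?a = P w (m - 1) + y *\<^sub>R v (w m)"
        using \<tau>'(2) unfolding mem_edge[OF m1] by blast
      show ?thesis
      proof (cases "m = k")
        case True
        then have "(\<sigma> + \<tau>) *\<^sub>R v ?a = x *\<^sub>R v ?a" using x A' by (simp add: scaleR_add_left)
        then have "\<sigma> + \<tau> = x" by simp
        then show ?thesis using outside[OF \<tau>(1)] x by auto
      next
        case False
        then have wm: "w m \<in> {1..n}" "?a \<noteq> w m"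
          using perm_in[OF w m] permutes_inj[OF w] by (auto dest: injD)
        have "A + \<tau> *\<^sub>R v ?a + y *\<^sub>R v (w m) = A + \<tau>' *\<^sub>R v ?a + x *\<^sub>R v (w m)"
          unfolding x(3) y by (simp only: add.assoc add.commute add.left_commute)
        then show ?thesis using coord_unique(1)[OF a wm] by blast
      qed
    qed
  qed
  have "{\<tau> \<in> I. A + \<tau> *\<^sub>R v ?a \<in> trail w} = (\<Union>m\<in>{1..n}. {\<tau> \<in> I. A + \<tau> *\<^sub>R v ?a \<in> E w m})"
    unfolding trail_def by blast
  then have "finite {\<tau> \<in> I. A + \<tau> *\<^sub>R v ?a \<in> trail w}" using fin by simp
  then obtain \<tau> where \<tau>: "\<tau> \<in> I" "A + \<tau> *\<^sub>R v ?a \<notin> trail w"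
    using I(1) by (metis (mono_tags, lifting) mem_Collect_eq rev_finite_subset subsetI)
  define z where "z = A + \<tau> *\<^sub>R v ?a"
  have \<tau>01: "0 < \<tau>" "\<tau> < 1" using \<tau>(1) I(2) by auto
  have in_side: "A + x *\<^sub>R v ?a \<in> closed_segment A (A + v ?a)" if "0 \<le> x" "x \<le> 1" for x
    unfolding in_segment using that by (intro exI[of _ x]) (simp add: algebra_simps)
  have side_t: "closed_segment A (A + v ?a) \<subseteq> t" using face_of_imp_subset[OF side] .
  have zt: "z \<in> t" using in_side[of \<tau>] side_t \<tau>01 by (auto simp: z_def)
  then have "z \<in> right_of id" "z \<in> left_of w" using tile_subset t by blast+
  then obtain t' e where t': "t' \<in> T" "e > 0" "z \<in> t'" "z + of_real e \<in> t'"
    using approach_from_right[of z] \<tau>(2) z_def by metis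
  have "z \<in> rel_interior (closed_segment A (A + v ?a))"
    unfolding z_def using interior_point_of_segment \<tau>01 cis_neq_zero by blast
  then have "t \<inter> t' \<inter> rel_interior (closed_segment A (A + v ?a)) \<noteq> {}"
    using zt t'(3) by auto
  then have "closed_segment A (A + v ?a) \<subseteq> t \<inter> t'"
    by (rule subset_of_face_of[OF tile_face(1)[OF t t'(1)] side_t])
  then have Qt': "A + \<alpha> *\<^sub>R v ?a \<in> t'" using in_side[of \<alpha>] \<alpha> by auto
  \<comment> \<open>A small step inside the new tile from the edge point towards
    \<open>z + of_real e\<close>. Since \<tau> and \<alpha> differ by at most 1, the bounds by
    \<open>s\<close> and \<open>1 - s\<close> keep the height within that of the edge, while the
    step leads strictly to its right.\<close>
  define l where "l = min s (1 - s) / 2"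
  have l: "0 < l" "l < s" "l < 1 - s" "l < 1" using s by (auto simp: l_def)
  have "(1 - l) *\<^sub>R (A + \<alpha> *\<^sub>R v ?a) + l *\<^sub>R (z + of_real e) \<in> t'"
    using l by (intro convexD[OF convex_tile[OF t'(1)] Qt' t'(4)]) auto
  moreover have "(1 - l) *\<^sub>R (A + \<alpha> *\<^sub>R v ?a) + l *\<^sub>R (z + of_real e) =
      ?p + (s + l * (\<tau> - \<alpha>)) *\<^sub>R v ?a + of_real (l * e)"
  proof -
    have comb: "(1 - l) *\<^sub>R (A + \<alpha> *\<^sub>R x) + l *\<^sub>R (A + \<tau> *\<^sub>R x + y) =
      A + (\<alpha> + l * (\<tau> - \<alpha>)) *\<^sub>R x + l *\<^sub>R y" for x y :: complex
      by (simp add: algebra_simps)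
    have "A + (\<alpha> + l * (\<tau> - \<alpha>)) *\<^sub>R v ?a = ?p + (s + l * (\<tau> - \<alpha>)) *\<^sub>R v ?a"
      using A' \<sigma>_def by (simp add: scaleR_add_left scaleR_diff_left)
    then show ?thesis unfolding z_def comb by (simp only: of_real_mult scaleR_conv_of_real)
  qed
  moreover have "0 \<le> s + l * (\<tau> - \<alpha>)" "s + l * (\<tau> - \<alpha>) \<le> 1"
  proof -
    have "\<bar>\<tau> - \<alpha>\<bar> \<le> 1" using \<tau>01 \<alpha> by linarith
    then have "\<bar>l * (\<tau> - \<alpha>)\<bar> \<le> l" unfolding abs_mult using l(1) by (simp add: mult_left_le)
    then show "0 \<le> s + l * (\<tau> - \<alpha>)" "s + l * (\<tau> - \<alpha>) \<le> 1" using l by linarith+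
  qed
  moreover have "0 < l * e" using l t'(2) by simp
  ultimately show False
    using right_of_right_trail[OF k, of "s + l * (\<tau> - \<alpha>)" "l * e"] tile_subset(2)[OF t'(1)] by (metis subsetD)
qed

text \<open>A side through an inner point of the edge must be parallel to it, since otherwise it
  would cross the right boundary there and leave the polygon. A parallel side cannot be shifted by
  \<open>side_at_right_edge\<close>, so it is the edge.\<close>

lemma right_edge_side:
  assumes k: "k \<in> {1..n}" and s: "0 < s" "s < 1"
    and ij: "i \<in> {1..n}" "j \<in> {1..n}" "i \<noteq> j" and t: "R p i j \<in> T"
    and \<alpha>: "0 < \<alpha>" "\<alpha> < 1" and \<beta>: "\<beta> = 0 \<or> \<beta> = 1"
    and Q: "P w (k - 1) + s *\<^sub>R v (w k) = p + \<alpha> *\<^sub>R v i + \<beta> *\<^sub>R v j"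
  shows "E w k face_of R p i j"
proof -
  let ?a = "w k" and ?q = "P w (k - 1) + s *\<^sub>R v (w k)"
  have a: "?a \<in> {1..n}" using perm_in[OF w k] .
  have ia: "i = ?a"
  proof (rule ccontr)
    assume "i \<noteq> ?a"
    then have cr: "wedge (v i) (v ?a) \<noteq> 0" using wedge_v_neq ij a by blast
    \<comment> \<open>Decomposes \<open>v i\<close> into a multiple of the edge direction and a
      horizontal rest \<open>c\<close>. The sign of \<open>c\<close> tells in which direction along
      the side the tile would reach beyond the boundary; \<open>d\<close> is small enough to stay
      within both the side and the height of the edge.\<close>
    define L where "L = Im (v i) / Im (v ?a)"
    define c where "c = Re (v i) - L * Re (v ?a)"
    have neg: "Im (v ?a) \<noteq> 0" using Im_v[OF a] by simp
    have vi: "v i = L *\<^sub>R v ?a + of_real c" using neg by (simp add: complex_eq_iff L_def c_def)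
    have "c \<noteq> 0" using cr unfolding vi wedge_add_left wedge_scaleR_left wedge_self wedge_of_real_left by auto
    define d where "d = min (min \<alpha> (1 - \<alpha>)) (min s (1 - s) / (\<bar>L\<bar> + 1))"
    have "d > 0" using \<alpha> s by (auto simp: d_def)
    have "d * \<bar>L\<bar> \<le> d * (\<bar>L\<bar> + 1)" using \<open>d > 0\<close> by simp
    also have "\<dots> \<le> min s (1 - s) / (\<bar>L\<bar> + 1) * (\<bar>L\<bar> + 1)" by (intro mult_right_mono) (auto simp: d_def)
    also have "\<dots> = min s (1 - s)" by simp
    finally have dL: "d * \<bar>L\<bar> \<le> min s (1 - s)" .
    define \<epsilon> where "\<epsilon> = sgn c * d"
    have \<epsilon>: "\<bar>\<epsilon>\<bar> = d" "\<epsilon> * c > 0" using \<open>c \<noteq> 0\<close> \<open>d > 0\<close> by (auto simp: \<epsilon>_def sgn_if abs_mult mult_pos_neg)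
    have "\<bar>\<epsilon> * L\<bar> \<le> min s (1 - s)" using dL \<epsilon> by (simp add: abs_mult)
    then have sL: "0 \<le> s + \<epsilon> * L" "s + \<epsilon> * L \<le> 1" by (auto simp: abs_le_iff)
    have "\<bar>\<epsilon>\<bar> \<le> \<alpha>" "\<bar>\<epsilon>\<bar> \<le> 1 - \<alpha>" unfolding \<epsilon>(1) d_def by auto
    then have mem: "p + (\<alpha> + \<epsilon>) *\<^sub>R v i + \<beta> *\<^sub>R v j \<in> R p i j" unfolding mem_rhombus
      using \<beta> by (intro exI[of _ "\<alpha> + \<epsilon>"] exI[of _ \<beta>]) auto
    have "p + (\<alpha> + \<epsilon>) *\<^sub>R v i + \<beta> *\<^sub>R v j = ?q + \<epsilon> *\<^sub>R v i"
      unfolding Q by (simp add: algebra_simps)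
    also have "\<epsilon> *\<^sub>R v i = (\<epsilon> * L) *\<^sub>R v ?a + of_real (\<epsilon> * c)"
      unfolding vi by (simp add: scaleR_conv_of_real distrib_left mult.assoc)
    also have "?q + ((\<epsilon> * L) *\<^sub>R v ?a + of_real (\<epsilon> * c)) = P w (k - 1) + (s + \<epsilon> * L) *\<^sub>R v ?a + of_real (\<epsilon> * c)"
      by (simp add: scaleR_add_left add.assoc)
    finally show False
      using right_of_right_trail[OF k sL \<epsilon>(2)] tile_subset(2)[OF t] mem by (metis subsetD)
  qed
  have side: "closed_segment (p + \<beta> *\<^sub>R v j) (p + \<beta> *\<^sub>R v j + v i) face_of R p i j"
    using rhombus_side_face[OF ij, of p] \<beta> by auto
  have "p + \<beta> *\<^sub>R v j = P w (k - 1)"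
    by (rule side_at_right_edge[OF k s t _ \<alpha>]) (use side ia Q in \<open>auto simp: algebra_simps\<close>)
  then show ?thesis using side ia E_pair(1)[of k w] k by auto
qed

text \<open>Tiles have finitely many vertices, so some inner point \<open>Q\<close> of the edge is
  none of them. The polygon ends to the right of \<open>Q\<close>, so \<open>Q\<close> is not
  interior to a tile either. Hence a tile reached from the left has \<open>Q\<close> in the relative
  interior of one of its sides.\<close>

lemma right_edge_face:
  assumes k: "k \<in> {1..n}" and free: "\<And>s. 0 < s \<Longrightarrow> s < 1 \<Longrightarrow> P w (k - 1) + s *\<^sub>R v (w k) \<notin> trail id"
  shows "\<exists>t\<in>T. E w k face_of t"
proof -
  have a: "w k \<in> {1..n}" using perm_in[OF w k] .
  define V where "V = (\<Union>t\<in>T. {x. x extreme_point_of t})"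
  have "finite {x. x extreme_point_of t}" if t: "t \<in> T" for t
  proof -
    obtain p i j where "t = R p i j" using tileE[OF t] by metis
    then have "{x. x extreme_point_of t} \<subseteq> {p, p + v i, p + v j, p + v i + v j}"
      unfolding rhombus_def using extreme_point_of_convex_hull by blast
    then show ?thesis by (rule finite_subset) simp
  qed
  then have "finite V" unfolding V_def using finite_T by blast
  moreover have "inj (\<lambda>s. P w (k - 1) + s *\<^sub>R v (w k))" by (auto simp: inj_def)
  ultimately have "finite ((\<lambda>s. P w (k - 1) + s *\<^sub>R v (w k)) -` V)" by (intro finite_vimageI)
  moreover have "infinite {0<..<1::real}" by (rule infinite_Ioo) simp
  ultimately obtain s where s: "0 < s" "s < 1" "P w (k - 1) + s *\<^sub>R v (w k) \<notin> V"
    by (metis greaterThanLessThan_iff rev_finite_subset subsetI vimageI)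
  define Q where "Q = P w (k - 1) + s *\<^sub>R v (w k)"
  have "Q \<in> trail w" using s k unfolding Q_def mem_trail by force
  then have "Q \<in> right_of id" "Q \<in> left_of w"
    using trail_subset_right_of[OF w] trail_subset_left_of[of w] by blast+
  moreover have "Q \<notin> trail id" using free s by (simp add: Q_def)
  ultimately obtain t e where t: "t \<in> T" "e > 0" "Q \<in> t" "Q - of_real e \<in> t"
    by (rule approach_from_left)
  obtain p i j where ij: "i \<in> {1..n}" "j \<in> {1..n}" "i \<noteq> j" and tR: "t = R p i j" using tileE[OF t(1)] by metis
  obtain \<alpha> \<beta> where ab: "0 \<le> \<alpha>" "\<alpha> \<le> 1" "0 \<le> \<beta>" "\<beta> \<le> 1" "Q = p + \<alpha> *\<^sub>R v i + \<beta> *\<^sub>R v j"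
    using t(3) unfolding tR mem_rhombus by blast
  have not_int: "Q \<notin> interior t"
  proof
    assume "Q \<in> interior t"
    then obtain \<epsilon> where \<epsilon>: "\<epsilon> > 0" "ball Q \<epsilon> \<subseteq> t" using mem_interior by blast
    then have "Q + of_real (\<epsilon> / 2) \<in> t" by (intro subsetD[OF \<epsilon>(2)]) (simp add: dist_norm)
    then show False using right_of_right_trail[OF k, of s "\<epsilon> / 2"] tile_subset(2)[OF t(1)] s \<epsilon>(1)
      unfolding Q_def by auto
  qed
  have edges: "(\<alpha> = 0 \<or> \<alpha> = 1) \<or> (\<beta> = 0 \<or> \<beta> = 1)"
    using not_int interior_rhombus[OF ij, of \<alpha> \<beta> p] ab unfolding tR by (metis less_eq_real_def)
  have not_vertex: "\<not> ((\<alpha> = 0 \<or> \<alpha> = 1) \<and> (\<beta> = 0 \<or> \<beta> = 1))"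
  proof
    assume corner: "(\<alpha> = 0 \<or> \<alpha> = 1) \<and> (\<beta> = 0 \<or> \<beta> = 1)"
    have "closed_segment (p + \<beta> *\<^sub>R v j) (p + \<beta> *\<^sub>R v j + v i) face_of t"
      using rhombus_side_face[OF ij, of p] corner unfolding tR by auto
    moreover have "Q = p + \<beta> *\<^sub>R v j \<or> Q = p + \<beta> *\<^sub>R v j + v i"
      using corner ab(5) by (auto simp: algebra_simps)
    ultimately have "Q extreme_point_of t"
      using extreme_point_of_face extreme_point_of_segment by metis
    then show False using s(3) t(1) by (auto simp: V_def Q_def)
  qed
  show ?thesis
  proof (cases "\<beta> = 0 \<or> \<beta> = 1")
    case True
    then have \<alpha>: "0 < \<alpha>" "\<alpha> < 1" using not_vertex ab by auto
    have "E w k face_of R p i j"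
      by (rule right_edge_side[OF k s(1,2) ij t(1)[unfolded tR] \<alpha> True ab(5)[unfolded Q_def]])
    then show ?thesis using t(1) unfolding tR by blast
  next
    case False
    then have \<beta>: "0 < \<beta>" "\<beta> < 1" and \<alpha>: "\<alpha> = 0 \<or> \<alpha> = 1" using edges ab by auto
    have tR': "t = R p j i" unfolding tR by (rule rhombus_commute)
    have "P w (k - 1) + s *\<^sub>R v (w k) = p + \<beta> *\<^sub>R v j + \<alpha> *\<^sub>R v i"
      using ab(5) unfolding Q_def by (simp only: add.assoc add.commute add.left_commute)
    then have "E w k face_of R p j i"
      by (rule right_edge_side[OF k s(1,2) ij(2,1) ij(3)[symmetric] t(1)[unfolded tR'] \<beta> \<alpha>])
    then show ?thesis using t(1) unfolding tR' by blast
  qed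
qed

text \<open>The given tile \<open>s\<close> may lie on either side of the edge. Approaching the
  midpoint from the left yields a tile sharing an inner point of the edge with \<open>s\<close>, so
  the edge-to-edge condition makes the whole edge a side of it. In the first case the edge starts at
  the top of that tile (the tile extends below), in the second it ends at the bottom (the tile
  extends above).\<close>

lemma tile_left_of_edge:
  assumes u: "u permutes {1..n}" and k: "k \<in> {1..n}" and face: "s \<in> T" "E u k face_of s"
    and mid: "P u (k - 1) + (1/2) *\<^sub>R v (u k) \<notin> trail id"
  obtains z where "z \<in> {1..n}" "z < u k" "R (P u (k - 1)) (u k) z \<in> T"
    | z where "z \<in> {1..n}" "u k < z" "R (P u (k - 1) - v z) z (u k) \<in> T"
proof -
  let ?a = "u k" and ?q = "P u (k - 1)"
  let ?M = "?q + (1/2) *\<^sub>R v ?a"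
  have a: "?a \<in> {1..n}" using perm_in[OF u k] .
  have seg: "E u k = closed_segment ?q (?q + v ?a)" using E_pair(1) k by auto
  have E_s: "E u k \<subseteq> s" using face_of_imp_subset[OF face(2)] .
  have "?M \<in> E u k" using k mem_edge[of k ?M u] by (force intro: exI[of _ "1/2"])
  then have Ms: "?M \<in> s" using E_s by blast
  then have "?M \<in> right_of id" "?M \<in> left_of w" using tile_subset face(1) by blast+
  then obtain t e where t: "t \<in> T" "e > 0" "?M \<in> t" "?M - of_real e \<in> t"
    using approach_from_left mid by metis
  have "?M \<in> rel_interior (E u k)"
    unfolding seg by (rule interior_point_of_segment) auto
  then have "s \<inter> t \<inter> rel_interior (E u k) \<noteq> {}" using Ms t(3) by auto
  then have sub: "E u k \<subseteq> s \<inter> t" by (rule subset_of_face_of[OF tile_face(1)[OF face(1) t(1)] E_s])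
  then have "E u k face_of (s \<inter> t)" using face_of_subset[OF face(2)] by blast
  then have Et: "E u k face_of t" using face_of_trans tile_face(2)[OF face(1) t(1)] by blast
  obtain p i j where ij: "i \<in> {1..n}" "j \<in> {1..n}" "i \<noteq> j" and tR: "t = R p i j" using tileE[OF t(1)] by metis
  have cases: "(?a = i \<and> (?q = p \<or> ?q = p + v j)) \<or> (?a = j \<and> (?q = p \<or> ?q = p + v i))"
    using rhombus_face_unit_segment[OF ij a, of ?q p] Et seg tR by simp
  have "\<exists>z\<in>{1..n}. z \<noteq> ?a \<and> (t = R ?q ?a z \<or> t = R (?q - v z) ?a z)"
    using cases
  proof (elim disjE conjE)
    assume "?a = i" "?q = p"
    then show ?thesis using ij tR by (intro bexI[of _ j]) auto
  next
    assume "?a = i" "?q = p + v j"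
    then show ?thesis using ij tR by (intro bexI[of _ j]) auto
  next
    assume "?a = j" "?q = p"
    then show ?thesis using ij tR rhombus_commute[of p i j] by (intro bexI[of _ i]) auto
  next
    assume "?a = j" "?q = p + v i"
    then show ?thesis using ij tR rhombus_commute[of p i j] by (intro bexI[of _ i]) auto
  qed
  then obtain z where z: "z \<in> {1..n}" "z \<noteq> ?a" and tz: "t = R ?q ?a z \<or> t = R (?q - v z) ?a z" by blast
  \<comment> \<open>The leftward step lies on the negative side of the edge direction, and so must
    the other label direction of a tile extending below; for a tile extending above the sign is
    reversed. This decides how the labels compare.\<close>
  have wneg: "wedge (v ?a) (of_real (- e)) < 0"
    using Im_v[OF a] t(2) unfolding wedge_of_real_right by (simp add: mult_pos_neg)
  from tz show ?thesis
  proof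
    assume tz: "t = R ?q ?a z"
    then obtain \<alpha> \<beta> where ab: "0 \<le> \<beta>" "?M - of_real e = ?q + \<alpha> *\<^sub>R v ?a + \<beta> *\<^sub>R v z"
      using t(4) unfolding tz mem_rhombus by blast
    have "of_real (- e) = (\<alpha> - 1/2) *\<^sub>R v ?a + \<beta> *\<^sub>R v z" using ab(2) by (simp add: algebra_simps)
    then have "wedge (v ?a) (of_real (- e)) = \<beta> * wedge (v ?a) (v z)" by (simp only: wedge_simps)
    then have "wedge (v ?a) (v z) < 0" using wneg ab(1) by (simp add: mult_less_0_iff)
    then have "z < ?a" using wedge_v[OF a z(1)] z(2) by (meson less_asym nat_neq_iff)
    then show ?thesis using that(1)[OF z(1)] tz t(1) by blast
  next
    assume tz: "t = R (?q - v z) ?a z"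
    then obtain \<alpha> \<beta> where ab: "\<beta> \<le> 1" "?M - of_real e = ?q - v z + \<alpha> *\<^sub>R v ?a + \<beta> *\<^sub>R v z"
      using t(4) unfolding tz mem_rhombus by blast
    have "of_real (- e) = (\<alpha> - 1/2) *\<^sub>R v ?a + (\<beta> - 1) *\<^sub>R v z" using ab(2) by (simp add: algebra_simps)
    then have "wedge (v ?a) (of_real (- e)) = (\<beta> - 1) * wedge (v ?a) (v z)" by (simp only: wedge_simps)
    then have "wedge (v ?a) (v z) > 0" using wneg ab(1) by (simp add: mult_less_0_iff)
    then have "?a < z" using wedge_v[OF z(1) a] z(2) wedge_commute[of "v z" "v ?a"] by force
    then show ?thesis using that(2)[OF z(1)] tz t(1) rhombus_commute by metis
  qed
qed

end

subsection \<open>Sweeping a tiling\<close>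

text \<open>The sum of the first \<open>n - 1\<close> prefix sums of \<open>u\<close>. An exchange
  at \<open>k\<close> alters only the \<open>k\<close>th of them, lowering it by
  \<open>u k - u (k + 1)\<close> at a descent, so this measure decreases along a sweep.\<close>

definition weight :: "nat \<Rightarrow> (nat \<Rightarrow> nat) \<Rightarrow> nat" where
  "weight n u = (\<Sum>i=1..n. (n - i) * u i)"

context elnitsky
begin

lemma weight_swapped:
  assumes k: "1 \<le> k" "k < n" and desc: "u (k + 1) < u k"
  shows "weight n (swapped u k) < weight n u"
proof -
  define A where "A = {1..n} - {k, k + 1}"
  have A: "{1..n} = A \<union> {k, k + 1}" "finite A" "A \<inter> {k, k + 1} = {}" using k by (auto simp: A_def)
  have split: "weight n f = (\<Sum>i\<in>A. (n - i) * f i) + ((n - k) * f k + (n - (k + 1)) * f (k + 1))" for f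
    unfolding weight_def A(1) by (subst sum.union_disjoint[OF A(2) _ A(3)]) simp_all
  have "(\<Sum>i\<in>A. (n - i) * swapped u k i) = (\<Sum>i\<in>A. (n - i) * u i)"
    by (rule sum.cong) (auto simp: A_def swapped_apply(3))
  moreover have "n - k = Suc (n - (k + 1))" using k by simp
  ultimately show ?thesis
    unfolding split swapped_apply(1,2) using desc by simp
qed

text \<open>By extremality the coefficients before \<open>k\<close>, all 1, belong to labels below
  some \<open>m\<close>, and those after \<open>k\<close>, all 0, to labels above it. Counting the
  labels below \<open>m\<close> gives \<open>m = k\<close>.\<close>

lemma on_left_trail_prefix:
  assumes u: "u permutes {1..n}" and k: "k \<in> {1..n}" and s: "0 < s" "s < 1"
    and on: "P u (k - 1) + s *\<^sub>R v (u k) \<in> trail id"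
  shows "u ` {1..k-1} = {1..k-1}" "u k = k"
proof -
  have c: "0 \<le> threshold k s j \<and> threshold k s j \<le> 1" for j using s by (simp add: threshold_def)
  have "(\<Sum>j=1..n. threshold k s j *\<^sub>R v (u j)) + of_real 0 \<in> trail id"
    using on trail_point_sum[OF k] by simp
  from left_path_extremal(2)[OF u c this order_refl]
  obtain m where m: "m \<in> {1..n}"
    and ext: "\<And>j. j \<in> {1..n} \<Longrightarrow> (u j < m \<longrightarrow> threshold k s j = 1) \<and> (u j > m \<longrightarrow> threshold k s j = 0)"
    by blast
  have ukm: "u k = m" using ext[OF k] s by (auto simp: threshold_def)
  have low: "u j < m \<longleftrightarrow> j < k" if j: "j \<in> {1..n}" for j
  proof
    assume "u j < m"
    then show "j < k" using ext[OF j] s by (auto simp: threshold_def split: if_splits)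
  next
    assume jk: "j < k"
    then have "\<not> u j > m" using ext[OF j] by (auto simp: threshold_def)
    moreover have "u j \<noteq> m" using ukm jk permutes_inj[OF u] by (metis injD less_irrefl)
    ultimately show "u j < m" by simp
  qed
  have im: "u ` {1..k-1} = {1..m-1}"
  proof (intro set_eqI iffI)
    fix i assume "i \<in> u ` {1..k-1}"
    then obtain j where j: "i = u j" "j \<in> {1..k-1}" by blast
    then have jn: "j \<in> {1..n}" using k by auto
    have "j < k" using j k by auto
    then have "u j < m" using low[OF jn] by simp
    then show "i \<in> {1..m-1}" using j(1) perm_in[OF u jn] by auto
  next
    fix i assume i: "i \<in> {1..m-1}"
    then have "i \<in> u ` {1..n}" using permutes_image[OF u] m by auto
    then obtain j where j: "i = u j" "j \<in> {1..n}" by blast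
    then have "j < k" using low[OF j(2)] i m by auto
    then show "i \<in> u ` {1..k-1}" using j by auto
  qed
  have "card (u ` {1..k-1}) = k - 1"
    using card_image[OF inj_on_subset[OF permutes_inj[OF u] subset_UNIV], of "{1..k-1}"] by simp
  then have "k = m" using im k m by auto
  then show "u ` {1..k-1} = {1..k-1}" "u k = k" using im ukm by auto
qed

text \<open>A touching point would make a prefix of \<open>u\<close> invariant. Full support enters
  the geometry through this lemma.\<close>

lemma fully_supported_not_on_left:
  assumes fs: "fully_supported n u" and u: "u permutes {1..n}" and k: "k \<in> {1..n}" and s: "0 < s" "s < 1"
  shows "P u (k - 1) + s *\<^sub>R v (u k) \<notin> trail id"
proof
  assume "P u (k - 1) + s *\<^sub>R v (u k) \<in> trail id"
  then have *: "u ` {1..k-1} = {1..k-1}" "u k = k" using on_left_trail_prefix[OF u k s] by blast+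
  \<comment> \<open>For \<open>k = 1\<close> the prefix of length \<open>k - 1\<close> is empty, so
    the contradiction comes from \<open>u 1 = 1\<close> instead.\<close>
  show False
  proof (cases "k = 1")
    case True
    then have "u ` {1..1} = {1..1}" using * by simp
    then show False using fs n_ge_2 unfolding fully_supported_def by force
  next
    case False
    then have "1 \<le> k - 1" "k - 1 < n" using k by auto
    then show False using fs *(1) unfolding fully_supported_def by blast
  qed
qed

end

context elnitsky_tiling
begin

text \<open>The invariant of the sweep. The side on which the tile lies is left open, so the
  invariant survives on edges that have already reached the left boundary, where the tile is on the
  right.\<close>

definition skeletal :: "(nat \<Rightarrow> nat) \<Rightarrow> bool" where
  "skeletal u \<longleftrightarrow> (\<forall>k\<in>{1..n}. \<exists>s\<in>T. E u k face_of s)"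

text \<open>Argued by contradiction: without an exchange, \<open>down\<close> is inherited from each
  edge by the next one, from the first free edge to edge \<open>n\<close>. But edge \<open>n\<close>
  ends at the bottom vertex, which lies on the left boundary and so cannot be a right
  corner.\<close>

lemma exists_flip:
  assumes u: "u permutes {1..n}" and skel: "skeletal u" and ne: "u \<noteq> id"
  obtains k where "1 \<le> k" "k < n" "u (k + 1) < u k" "R (P u (k - 1)) (u k) (u (k + 1)) \<in> T"
proof (rule ccontr)
  assume "\<not> thesis"
  then have no_flip: "\<lbrakk>1 \<le> k; k < n; u (k + 1) < u k; R (P u (k - 1)) (u k) (u (k + 1)) \<in> T\<rbrakk> \<Longrightarrow> False" for k
    using that[of k] by blast
  define free where "free k \<longleftrightarrow> P u (k - 1) + (1/2) *\<^sub>R v (u k) \<notin> trail id" for k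
  define down where "down k \<longleftrightarrow> (\<exists>z\<in>{1..n}. z < u k \<and> R (P u (k - 1)) (u k) z \<in> T)" for k
  define up where "up k \<longleftrightarrow> (\<exists>z\<in>{1..n}. u k < z \<and> R (P u (k - 1) - v z) z (u k) \<in> T)" for k
  have not_free: "u ` {1..k-1} = {1..k-1}" "u k = k" if "k \<in> {1..n}" "\<not> free k" for k
    using on_left_trail_prefix[OF u that(1), of "1/2"] that(2) by (simp_all add: free_def)
  have tile: "down k \<or> up k" if k: "k \<in> {1..n}" and f: "free k" for k
  proof -
    obtain s where s: "s \<in> T" "E u k face_of s" using skel k unfolding skeletal_def by blast
    show ?thesis
      using tile_left_of_edge[OF u k s f[unfolded free_def]] unfolding down_def up_def by metis
  qed
  \<comment> \<open>The lower end of a \<open>down\<close> edge is the right corner of its tile; for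
    an \<open>up\<close> edge this is the upper end.\<close>
  have down_next: "P u k \<notin> trail id" if k: "k \<in> {1..n}" and d: "down k" for k
  proof -
    obtain z where z: "z \<in> {1..n}" "z < u k" "R (P u (k - 1)) (u k) z \<in> T" using d unfolding down_def by blast
    have "P u (k - 1) = P u k - v (u k)" using P_step[of k u] k by simp
    then show ?thesis using corner_not_on_left[OF perm_in[OF u k] z(1,2)] z(3) by simp
  qed
  have up_prev: "P u (k - 1) \<notin> trail id" if k: "k \<in> {1..n}" and d: "up k" for k
  proof -
    obtain z where z: "z \<in> {1..n}" "u k < z" "R (P u (k - 1) - v z) z (u k) \<in> T" using d unfolding up_def by blast
    then show ?thesis using corner_not_on_left[OF z(1) perm_in[OF u k] z(2,3)] by simp
  qed
  have ex: "\<exists>k. k \<in> {1..n} \<and> free k"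
  proof (rule ccontr)
    assume "\<not> ?thesis"
    then have "u k = k" if "k \<in> {1..n}" for k using not_free(2)[OF that] that by blast
    then have "u k = id k" for k using permutes_not_in[OF u, of k] by (cases "k \<in> {1..n}") auto
    then show False using ne by auto
  qed
  define k0 where "k0 = (LEAST k. k \<in> {1..n} \<and> free k)"
  have k0: "k0 \<in> {1..n}" "free k0" using LeastI_ex[OF ex] unfolding k0_def by blast+
  have min: "\<not> (k \<in> {1..n} \<and> free k)" if "k < k0" for k
    using not_less_Least that unfolding k0_def by blast
  have "P u (k0 - 1) = P id (k0 - 1)" unfolding path_vertex_def
  proof (rule sum.cong)
    fix i assume "i \<in> {1..k0 - 1}"
    then have "i \<in> {1..n}" "i < k0" using k0 by auto
    then show "v (u i) = v (id i)" using not_free(2)[of i] min[of i] by simp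
  qed simp
  then have "P u (k0 - 1) \<in> trail id" using P_in_trail[of "k0 - 1" id] k0 by auto
  then have start: "down k0" using tile[OF k0] up_prev[OF k0(1)] by blast
  have "down (k0 + d)" if "k0 + d \<le> n" for d
    using that
  proof (induction d)
    case 0
    then show ?case using start by simp
  next
    case (Suc d)
    define k where "k = k0 + d"
    have k: "k \<in> {1..n}" "k + 1 \<in> {1..n}" using Suc.prems k0 by (auto simp: k_def)
    have dk: "down k" using Suc by (simp add: k_def)
    \<comment> \<open>An edge on the left boundary starts at a vertex of that boundary, which the
      end of a \<open>down\<close> edge is not.\<close>
    have "free (k + 1)"
    proof (rule ccontr)
      assume "\<not> free (k + 1)"
      then have "u ` {1..k} = id ` {1..k}" using not_free(1)[OF k(2)] by simp
      then have "P u k = P id k" by (rule P_image_eq[OF u permutes_id])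
      then show False using down_next[OF k(1) dk] P_in_trail[of k id] k by auto
    qed
    moreover have "\<not> up (k + 1)"
    proof
      assume "up (k + 1)"
      then obtain y where y: "y \<in> {1..n}" "u (k + 1) < y" "R (P u k - v y) y (u (k + 1)) \<in> T"
        unfolding up_def by auto
      obtain z where z: "z \<in> {1..n}" "z < u k" "R (P u (k - 1)) (u k) z \<in> T"
        using dk unfolding down_def by blast
      have Pk: "P u (k - 1) = P u k - v (u k)" using P_step[of k u] k by simp
      have "y = u k" "u (k + 1) = z"
        using corner_tile_unique[OF perm_in[OF u k(1)] z(1,2) z(3)[unfolded Pk] y(1) perm_in[OF u k(2)] y(2,3)]
        by simp_all
      then show False using no_flip[of k] k z y by auto
    qed
    ultimately have "down (k + 1)" using tile[OF k(2)] by blast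
    then show ?case by (simp add: k_def)
  qed
  from this[of "n - k0"] have "down n" using k0 by simp
  then have "P u n \<notin> trail id" using down_next[of n] n_ge_2 by simp
  then show False using P_total[OF u] P_in_trail[of n id] by simp
qed

lemma skeletal_swapped:
  assumes u: "u permutes {1..n}" and skel: "skeletal u" and k: "1 \<le> k" "k < n" and desc: "u (k + 1) < u k"
    and t: "R (P u (k - 1)) (u k) (u (k + 1)) \<in> T"
  shows "skeletal (swapped u k)"
  unfolding skeletal_def
proof
  fix m assume m: "m \<in> {1..n}"
  have ij: "u k \<in> {1..n}" "u (k + 1) \<in> {1..n}" "u k \<noteq> u (k + 1)" using perm_in[OF u] k desc by auto
  consider "m = k" | "m = k + 1" | "m \<noteq> k" "m \<noteq> k + 1" by blast
  then show "\<exists>s\<in>T. E (swapped u k) m face_of s"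
  proof cases
    case 1
    have "E (swapped u k) k face_of R (P u (k - 1)) (u k) (u (k + 1))"
      unfolding E_swapped(2)[OF k(1) k(1)] rhombus_commute[of _ "u k"]
      by (rule rhombus_side_face(1)[OF ij(2,1) ij(3)[symmetric]])
    then show ?thesis using t 1 by blast
  next
    case 2
    have "E (swapped u k) (k + 1) face_of R (P u (k - 1)) (u k) (u (k + 1))"
      unfolding E_swapped(3)[OF k(1) k(1)] by (rule rhombus_side_face(2)[OF ij])
    then show ?thesis using t 2 by blast
  next
    case 3
    have "E (swapped u k) m = E u m" by (rule E_swapped(1)) (use 3 k m in auto)
    then show ?thesis using skel m unfolding skeletal_def by simp
  qed
qed

text \<open>
  The path \<open>u\<close> sweeps from the right to the left boundary; a tile is passed exactly when the two
  edges of the path that it touches are exchanged.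
\<close>

lemma tile_labels_inverted_below:
  assumes "u permutes {1..n}" "skeletal u" "interior (R p i j) \<subseteq> left_of u"
    and ij: "i \<in> {1..n}" "j \<in> {1..n}" "i < j" and t: "R p i j \<in> T"
  shows "\<exists>a b. 1 \<le> a \<and> a < b \<and> b \<le> n \<and> u a = j \<and> u b = i"
  using assms(1-3)
proof (induction "weight n u" arbitrary: u rule: less_induct)
  case less
  note u = less.prems(1)
  \<comment> \<open>An interior point of the tile can be shifted right and still be left of the left
    boundary, although the tile lies to the right of that boundary.\<close>
  have ne: "u \<noteq> id"
  proof
    assume "u = id"
    define q where "q = p + (1/2) *\<^sub>R v i + (1/2) *\<^sub>R v j"
    have "q \<in> interior (R p i j)" unfolding q_def by (rule interior_rhombus) (use ij in auto)
    then obtain e where e: "e > 0" "ball q e \<subseteq> interior (R p i j)"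
      using open_contains_ball[of "interior (R p i j)"] by auto
    have "q + of_real (e / 2) \<in> ball q e" using e(1) by (simp add: dist_norm)
    then have "q + of_real (e / 2) \<in> left_of id" using e(2) less.prems(3) \<open>u = id\<close> by blast
    then obtain r where r: "r \<ge> 0" "q + of_real (e / 2) + of_real r \<in> trail id" by (auto simp: left_of_def)
    have "q \<in> right_of id"
      using \<open>q \<in> interior _\<close> interior_subset tile_subset(1)[OF t] by blast
    moreover have "q + of_real (e / 2 + r) \<in> trail id" using r(2) by (simp add: add.assoc)
    ultimately have "e / 2 + r = 0" using right_of_not_left r(1) e(1) by (meson add_nonneg_nonneg half_gt_zero less_imp_le)
    then show False using r(1) e(1) by simp
  qed
  obtain k where k: "1 \<le> k" "k < n" and desc: "u (k + 1) < u k"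
    and s: "R (P u (k - 1)) (u k) (u (k + 1)) \<in> T" (is "?s \<in> T")
    by (rule exists_flip[OF u less.prems(2) ne])
  have uk: "u k \<in> {1..n}" "u (k + 1) \<in> {1..n}" using perm_in[OF u] k by auto
  show ?case
  proof (cases "R p i j = ?s")
    case True
    then have "{i, j} = {u k, u (k + 1)}"
      using rhombus_labels_unique[of i j "u k" "u (k + 1)"] ij uk desc by simp
    then have "u k = j" "u (k + 1) = i" using ij(3) desc by (auto simp: doubleton_eq_iff)
    then show ?thesis using k by (intro exI[of _ k] exI[of _ "k + 1"]) simp
  next
    case False
    have "interior (R p i j) \<subseteq> left_of (swapped u k)"
    proof
      fix q assume q: "q \<in> interior (R p i j)"
      then have "q \<notin> ?s" using tile_eqI[OF t s] False by blast
      moreover have "q \<in> left_of u" using q less.prems(3) by blast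
      ultimately show "q \<in> left_of (swapped u k)" using left_of_swapped[OF u k desc] by blast
    qed
    then obtain a b where ab: "1 \<le> a" "a < b" "b \<le> n" "swapped u k a = j" "swapped u k b = i"
      using less.hyps[OF weight_swapped[of k u]] k desc swapped_permutes[OF u k]
        skeletal_swapped[OF u less.prems(2) k desc s] by blast
    \<comment> \<open>Exchanging the positions \<open>k\<close> and \<open>k + 1\<close> preserves
      the order of \<open>a\<close> and \<open>b\<close> unless they are these two positions; then
      \<open>j\<close> would be the smaller label, as \<open>u\<close> descends at
      \<open>k\<close>.\<close>
    have ne: "\<not> (a = k \<and> b = k + 1)" using ab(4,5) swapped_apply(1,2)[of u k] desc ij(3) by auto
    define \<tau> where "\<tau> m = (if m = k then k + 1 else if m = k + 1 then k else m)" for m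
    have sw: "swapped u k m = u (\<tau> m)" for m
      using swapped_apply(1,2)[of u k] swapped_apply(3)[of m k u] by (auto simp: \<tau>_def)
    have "1 \<le> \<tau> a" "\<tau> a < \<tau> b" "\<tau> b \<le> n" using ab(1-3) ne k by (auto simp: \<tau>_def)
    then show ?thesis using ab(4,5) unfolding sw by blast
  qed
qed

section \<open>From inversions to the forced tile\<close>

lemma skeletal_right:
  assumes "fully_supported n w" shows "skeletal w"
  unfolding skeletal_def using right_edge_face fully_supported_not_on_left[OF assms w] by blast

lemma tile_labels_inverted:
  assumes "fully_supported n w" and ij: "i \<in> {1..n}" "j \<in> {1..n}" "i < j" and t: "R p i j \<in> T"
  obtains a b where "1 \<le> a" "a < b" "b \<le> n" "w a = j" "w b = i"
proof -
  have "interior (R p i j) \<subseteq> left_of w" using tile_subset(2)[OF t] interior_subset by blast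
  then show ?thesis
    using tile_labels_inverted_below[OF w skeletal_right[OF assms(1)] _ ij t] that by blast
qed

lemma aff_dim_path_edge: "k \<in> {1..n} \<Longrightarrow> aff_dim (E u k) = 1"
  by (simp add: E_pair(1) segment_convex_hull aff_dim_convex_hull aff_dim_2)

lemma right_perimeter_tile_exists:
  assumes fs: "fully_supported n w" and k: "1 \<le> k" "k < n" and desc: "w (k + 1) < w k"
    and max: "\<And>j. 1 \<le> j \<Longrightarrow> j < k \<Longrightarrow> w j < w k"
    and min: "\<And>j. k + 1 < j \<Longrightarrow> j \<le> n \<Longrightarrow> w (k + 1) < w j"
  shows "\<exists>t\<in>T. has_labels \<theta> t (w k) (w (k + 1)) \<and> right_perimeter_tile n \<theta> w t"
proof -
  have kk: "k \<in> {1..n}" "k + 1 \<in> {1..n}" using k by auto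
  note wk = perm_in[OF w kk(1)] and wk1 = perm_in[OF w kk(2)]
  have inj: "w a = w b \<Longrightarrow> a = b" for a b using permutes_inj[OF w] by (auto dest: injD)
  obtain s1 where s1: "s1 \<in> T" "E w k face_of s1" using skeletal_right[OF fs] kk unfolding skeletal_def by blast
  obtain s2 where s2: "s2 \<in> T" "E w (k + 1) face_of s2" using skeletal_right[OF fs] kk unfolding skeletal_def by blast
  have Pk: "P w (k - 1) = P w k - v (w k)" using P_step[of k w] k by simp
  \<comment> \<open>The alternative, a tile extending above the edge, would have a larger label
    \<open>z\<close> inverted with \<open>w k\<close>, hence a larger value before position
    \<open>k\<close>.\<close>
  have "\<exists>z\<in>{1..n}. z < w k \<and> R (P w (k - 1)) (w k) z \<in> T"
  proof (rule tile_left_of_edge[OF w kk(1) s1])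
    show "P w (k - 1) + (1/2) *\<^sub>R v (w k) \<notin> trail id"
      by (rule fully_supported_not_on_left[OF fs w kk(1)]) auto
    fix z assume z: "z \<in> {1..n}" "w k < z" "R (P w (k - 1) - v z) z (w k) \<in> T"
    obtain a b where ab: "1 \<le> a" "a < b" "b \<le> n" "w a = z" "w b = w k"
      by (rule tile_labels_inverted[OF fs wk z(1,2) z(3)[unfolded rhombus_commute[of _ z]]])
    then show ?thesis using inj[OF ab(5)] max[of a] z(2) by simp
  qed blast
  then obtain z where z: "z \<in> {1..n}" "z < w k" "R (P w (k - 1)) (w k) z \<in> T" by blast
  have "\<exists>z\<in>{1..n}. w (k + 1) < z \<and> R (P w k - v z) z (w (k + 1)) \<in> T"
  proof (rule tile_left_of_edge[OF w kk(2) s2])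
    show "P w (k + 1 - 1) + (1/2) *\<^sub>R v (w (k + 1)) \<notin> trail id"
      by (rule fully_supported_not_on_left[OF fs w kk(2)]) auto
    fix z assume z: "z \<in> {1..n}" "z < w (k + 1)" "R (P w (k + 1 - 1)) (w (k + 1)) z \<in> T"
    obtain a b where ab: "1 \<le> a" "a < b" "b \<le> n" "w a = w (k + 1)" "w b = z"
      by (rule tile_labels_inverted[OF fs z(1) wk1 z(2) z(3)[unfolded rhombus_commute[of _ "w (k + 1)"]]])
    then show ?thesis using inj[OF ab(4)] min[of b] z(2) by simp
  qed auto
  then obtain y where y: "y \<in> {1..n}" "w (k + 1) < y" "R (P w k - v y) y (w (k + 1)) \<in> T" by blast
  \<comment> \<open>The two tiles share the right corner \<open>P w k\<close>, so they are the same
    tile.\<close>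
  have "w (k + 1) = z"
    using corner_tile_unique(2)[OF wk z(1,2) z(3)[unfolded Pk] y(1) wk1 y(2,3)] .
  then have t: "R (P w (k - 1)) (w k) (w (k + 1)) \<in> T" (is "?t \<in> T") using z(3) by simp
  have ne: "w k \<noteq> w (k + 1)" using desc by simp
  have "E w k face_of ?t" unfolding E_pair(1)[OF k(1)] by (rule rhombus_side_face(1)[OF wk wk1 ne])
  moreover have "E w (k + 1) face_of ?t"
    unfolding E_pair(2)[OF k(1)] rhombus_commute[of _ "w k"] by (rule rhombus_side_face(2)[OF wk1 wk ne[symmetric]])
  ultimately have "right_perimeter_tile n \<theta> w ?t"
    unfolding right_perimeter_tile_def edge_of_def using k aff_dim_path_edge[OF kk(1)] aff_dim_path_edge[OF kk(2)] by blast
  then show ?thesis using t unfolding has_labels_def by blast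
qed

end

subsection \<open>Tilings from sequences of exchanges\<close>

context elnitsky
begin

text \<open>A relation and not a function of \<open>u\<close>, since the tiles depend on the order
  of the exchanges. The tile added last is the one adjacent to the path \<open>u\<close> on its
  left.\<close>

inductive tiled :: "(nat \<Rightarrow> nat) \<Rightarrow> complex set set \<Rightarrow> bool" where
  tiled_id: "tiled id {}"
| tiled_flip: "\<lbrakk>tiled (swapped u k) T; u permutes {1..n}; 1 \<le> k; k < n; u (k + 1) < u k\<rbrakk> \<Longrightarrow>
    tiled u (insert (R (P u (k - 1)) (u k) (u (k + 1))) T)"

lemma tiled_finite: "tiled u T \<Longrightarrow> finite T"
  by (induction rule: tiled.induct) auto

lemma tiled_labels:
  "tiled u T \<Longrightarrow> t \<in> T \<Longrightarrow> \<exists>p. \<exists>i\<in>{1..n}. \<exists>j\<in>{1..n}. i \<noteq> j \<and> t = R p i j"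
proof (induction rule: tiled.induct)
  case (tiled_flip u k T)
  have "u k \<in> {1..n}" "u (k + 1) \<in> {1..n}" "u k \<noteq> u (k + 1)"
    using perm_in[OF tiled_flip.hyps(2)] tiled_flip.hyps by auto
  then show ?case using tiled_flip.IH tiled_flip.prems by blast
qed simp

lemma right_of_move:
  assumes "z - of_real r \<in> right_of u" "r \<ge> 0" shows "z \<in> right_of u"
proof -
  obtain a where "a \<ge> 0" "z - of_real r - of_real a \<in> trail u" using assms(1) by (auto simp: right_of_def)
  then show ?thesis using right_ofI[of "r + a" z u] assms(2) by (simp add: diff_diff_eq)
qed

lemma bent_subset_trail:
  assumes "1 \<le> k" "k < n"
  shows "bent (P u (k - 1)) (u (k + 1)) (u k) \<subseteq> trail (swapped u k)"
  using trail_swapped[OF assms, of u] by (metis Un_upper2)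

lemma flip_tile_right_of:
  assumes u: "u permutes {1..n}" and k: "1 \<le> k" "k < n" and desc: "u (k + 1) < u k"
  shows "R (P u (k - 1)) (u k) (u (k + 1)) \<subseteq> right_of id"
proof
  have ij: "u k \<in> {1..n}" "u (k + 1) \<in> {1..n}" using perm_in[OF u] k by auto
  fix z assume "z \<in> R (P u (k - 1)) (u k) (u (k + 1))"
  then obtain r where r: "r \<ge> 0" "z - of_real r \<in> bent (P u (k - 1)) (u (k + 1)) (u k)"
    by (rule rhombus_move_left[OF ij desc])
  then have "z - of_real r \<in> right_of id"
    using bent_subset_trail[OF k] trail_subset_right_of[OF swapped_permutes[OF u k]] by blast
  then show "z \<in> right_of id" using right_of_move r(1) by blast
qed

lemma tiled_subset: "tiled u T \<Longrightarrow> t \<in> T \<Longrightarrow> t \<subseteq> right_of id \<inter> left_of u"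
proof (induction rule: tiled.induct)
  case (tiled_flip u k T)
  then show ?case
    using left_of_swapped[OF tiled_flip.hyps(2-5)] flip_tile_right_of[OF tiled_flip.hyps(2-5)] by blast
qed simp

text \<open>The set \<open>trail id\<close> accounts for stretches where \<open>u\<close> still runs
  along the left boundary and the region has no width, in particular for
  \<open>u = id\<close>.\<close>

lemma tiled_covers: "tiled u T \<Longrightarrow> right_of id \<inter> left_of u \<subseteq> \<Union>T \<union> trail id"
proof (induction rule: tiled.induct)
  case tiled_id
  show ?case
  proof
    fix z assume z: "z \<in> right_of id \<inter> left_of id"
    then obtain r where r: "r \<ge> 0" "z + of_real r \<in> trail id" by (auto simp: left_of_def)
    then have "r = 0" using right_of_not_left z by blast
    then show "z \<in> \<Union>{} \<union> trail id" using r by simp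
  qed
next
  case (tiled_flip u k T)
  then show ?case using left_of_swapped[OF tiled_flip.hyps(2-5)] by blast
qed

section \<open>Gluing an exchanged tile to the tiles on its left\<close>

lemma flip_tile_edges:
  assumes u: "u permutes {1..n}" and k: "1 \<le> k" "k < n" and desc: "u (k + 1) < u k"
  defines "t \<equiv> R (P u (k - 1)) (u k) (u (k + 1))"
  shows "E u k face_of t" "E u (k + 1) face_of t"
    and "E (swapped u k) k face_of t" "E (swapped u k) (k + 1) face_of t"
proof -
  have ij: "u k \<in> {1..n}" "u (k + 1) \<in> {1..n}" "u k \<noteq> u (k + 1)" using perm_in[OF u] k desc by auto
  have t': "t = R (P u (k - 1)) (u (k + 1)) (u k)" unfolding t_def by (rule rhombus_commute)
  show "E u k face_of t" unfolding t_def E_pair(1)[OF k(1)] by (rule rhombus_side_face(1)[OF ij])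
  show "E u (k + 1) face_of t" unfolding t' E_pair(2)[OF k(1)]
    by (rule rhombus_side_face(2)[OF ij(2,1) ij(3)[symmetric]])
  show "E (swapped u k) k face_of t" unfolding t' E_swapped(2)[OF k(1) k(1)]
    by (rule rhombus_side_face(1)[OF ij(2,1) ij(3)[symmetric]])
  show "E (swapped u k) (k + 1) face_of t" unfolding t_def E_swapped(3)[OF k(1) k(1)]
    by (rule rhombus_side_face(2)[OF ij])
qed

text \<open>An edge of the current path leaves it only through an exchange, and then it is a side of
  the new tile. This later removes the exceptional set \<open>trail id\<close> from the
  covering.\<close>

lemma tiled_left_edges: "tiled u T \<Longrightarrow> m \<in> {1..n} \<Longrightarrow> E id m \<subseteq> \<Union>T \<or> E id m = E u m"
proof (induction rule: tiled.induct)
  case (tiled_flip u k T)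
  note edges = flip_tile_edges(3,4)[OF tiled_flip.hyps(2-5), THEN face_of_imp_subset]
  consider "E id m \<subseteq> \<Union>T" | "E id m = E (swapped u k) m" using tiled_flip.IH tiled_flip.prems by blast
  then show ?case
  proof cases
    case 2
    consider "m = k" | "m = k + 1" | "m \<noteq> k" "m \<noteq> k + 1" by blast
    then show ?thesis
    proof cases
      case 3
      have "E (swapped u k) m = E u m" by (rule E_swapped(1)) (use 3 tiled_flip in auto)
      then show ?thesis using 2 by (metis (no_types))
    qed (use 2 edges in blast)+
  qed blast
qed simp

text \<open>From any point of the tile a leftward move of some length \<open>a\<close> reaches the
  new path, which has no other point at that height. A point that is also left of the new path must
  therefore have \<open>a = 0\<close>.\<close>

lemma flip_tile_left_of:
  assumes u: "u permutes {1..n}" and k: "1 \<le> k" "k < n" and desc: "u (k + 1) < u k"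
    and z: "z \<in> R (P u (k - 1)) (u k) (u (k + 1))" "z \<in> left_of (swapped u k)"
  shows "z \<in> bent (P u (k - 1)) (u (k + 1)) (u k)"
    and "e > 0 \<Longrightarrow> z + of_real e \<notin> left_of (swapped u k)"
proof -
  have ij: "u k \<in> {1..n}" "u (k + 1) \<in> {1..n}" using perm_in[OF u] k by auto
  obtain a where a: "a \<ge> 0" "z - of_real a \<in> bent (P u (k - 1)) (u (k + 1)) (u k)"
    by (rule rhombus_move_left[OF ij desc z(1)])
  then have a': "z + of_real (- a) \<in> trail (swapped u k)" using bent_subset_trail[OF k, of u] by auto
  have *: "e + r = - a" if "z + of_real e + of_real r \<in> trail (swapped u k)" for e r
    by (rule trail_shift[OF swapped_permutes[OF u k] _ a']) (use that in \<open>simp add: add.assoc\<close>)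
  obtain r where r: "r \<ge> 0" "z + of_real r \<in> trail (swapped u k)" using z(2) by (auto simp: left_of_def)
  have "a = 0" using *[of 0 r] r a(1) by simp
  then show "z \<in> bent (P u (k - 1)) (u (k + 1)) (u k)" using a(2) by simp
  show "z + of_real e \<notin> left_of (swapped u k)" if e: "e > 0"
  proof
    assume "z + of_real e \<in> left_of (swapped u k)"
    then obtain r where "r \<ge> 0" "z + of_real e + of_real r \<in> trail (swapped u k)" by (auto simp: left_of_def)
    then show False using *[of e r] e a(1) by simp
  qed
qed

lemma flip_tile_interior_disjoint:
  assumes u: "u permutes {1..n}" and k: "1 \<le> k" "k < n" and desc: "u (k + 1) < u k"
    and s: "s \<subseteq> left_of (swapped u k)"
  shows "interior s \<inter> interior (R (P u (k - 1)) (u k) (u (k + 1))) = {}" (is "_ \<inter> interior ?t = {}")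
proof (rule ccontr)
  assume "interior s \<inter> interior ?t \<noteq> {}"
  then obtain q where q: "q \<in> interior s" "q \<in> interior ?t" by blast
  obtain e where e: "e > 0" "ball q e \<subseteq> interior s" using q(1) open_contains_ball[of "interior s"] by auto
  have "q + of_real (e / 2) \<in> ball q e" using e(1) by (simp add: dist_norm)
  then have "q + of_real (e / 2) \<in> left_of (swapped u k)" using e(2) s interior_subset by blast
  moreover have "q \<in> left_of (swapped u k)" "q \<in> ?t" using q s interior_subset by blast+
  ultimately show False using flip_tile_left_of(2)[OF u k desc] e(1) by (meson half_gt_zero)
qed

lemma tiled_interior_disjoint:
  "tiled u T \<Longrightarrow> pairwise (\<lambda>s t. interior s \<inter> interior t = {}) T"
proof (induction rule: tiled.induct)
  case (tiled_flip u k T)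
  have "interior s \<inter> interior (R (P u (k - 1)) (u k) (u (k + 1))) = {}" if s: "s \<in> T" for s
    by (rule flip_tile_interior_disjoint[OF tiled_flip.hyps(2-5)])
      (use tiled_subset[OF tiled_flip.hyps(1) s] in blast)
  then show ?case using tiled_flip.IH by (simp add: pairwise_insert Int_commute)
qed simp

text \<open>If both legs had a point of their own, the midpoint of two such points would lie
  strictly inside the angle and on neither leg. The condition on the bend ensures that neither point
  is the bend itself.\<close>

lemma convex_subset_bent:
  assumes ij: "i \<in> {1..n}" "j \<in> {1..n}" "i \<noteq> j"
    and A: "A \<subseteq> closed_segment p (p + v i)" and B: "B \<subseteq> closed_segment (p + v i) (p + v i + v j)"
    and conv: "convex (A \<union> B)" and corner: "p + v i \<in> A \<longleftrightarrow> p + v i \<in> B"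
  shows "A \<subseteq> B \<or> B \<subseteq> A"
proof (rule ccontr)
  assume "\<not> ?thesis"
  then obtain a b where ab: "a \<in> A" "a \<notin> B" "b \<in> B" "b \<notin> A" by blast
  have "a \<in> closed_segment p (p + v i)" using ab(1) A by blast
  then obtain \<alpha> where \<alpha>: "\<alpha> \<le> 1" "a = p + \<alpha> *\<^sub>R v i" unfolding in_segment by (auto simp: algebra_simps)
  have "b \<in> closed_segment (p + v i) (p + v i + v j)" using ab(3) B by blast
  then obtain \<beta> where \<beta>: "0 \<le> \<beta>" "b = p + v i + \<beta> *\<^sub>R v j" unfolding in_segment by (auto simp: algebra_simps)
  have "\<alpha> \<noteq> 1" using ab(1,2) corner \<alpha> by auto
  have "\<beta> \<noteq> 0" using ab(3,4) corner \<beta> by auto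
  have "(1/2) *\<^sub>R a + (1/2) *\<^sub>R b \<in> A \<union> B" by (rule convexD[OF conv]) (use ab in auto)
  then have "(1/2) *\<^sub>R a + (1/2) *\<^sub>R b \<in> bent p i j" using A B unfolding bent_def by blast
  moreover have "(1/2) *\<^sub>R a + (1/2) *\<^sub>R b = p + ((\<alpha> + 1) / 2) *\<^sub>R v i + (\<beta> / 2) *\<^sub>R v j"
    unfolding \<alpha>(2) \<beta>(2) by (simp add: complex_eq_iff field_simps)
  ultimately obtain c where c: "p + ((\<alpha> + 1) / 2) *\<^sub>R v i + (\<beta> / 2) *\<^sub>R v j = p + c *\<^sub>R v i + 0 *\<^sub>R v j \<or>
      p + ((\<alpha> + 1) / 2) *\<^sub>R v i + (\<beta> / 2) *\<^sub>R v j = p + 1 *\<^sub>R v i + c *\<^sub>R v j"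
    unfolding mem_bent by metis
  then have "\<beta> / 2 = 0 \<or> (\<alpha> + 1) / 2 = 1" using coord_unique[OF ij] by blast
  then show False using \<open>\<alpha> \<noteq> 1\<close> \<open>\<beta> \<noteq> 0\<close> by auto
qed

text \<open>The intersection is convex and lies on the left half of the new tile, so it is contained
  in one of the two sides there. A face of a side is a face of the tile.\<close>

lemma flip_tile_meets_old_tile:
  assumes u: "u permutes {1..n}" and k: "1 \<le> k" "k < n" and desc: "u (k + 1) < u k"
    and s: "s \<subseteq> left_of (swapped u k)" "convex s"
    and faces: "\<And>m. m \<in> {1..n} \<Longrightarrow>
      (s \<inter> E (swapped u k) m) face_of s \<and> (s \<inter> E (swapped u k) m) face_of E (swapped u k) m"
  defines "t \<equiv> R (P u (k - 1)) (u k) (u (k + 1))"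
  shows "(s \<inter> t) face_of s" "(s \<inter> t) face_of t"
proof -
  have kk: "k \<in> {1..n}" "k + 1 \<in> {1..n}" using k by auto
  have ij: "u (k + 1) \<in> {1..n}" "u k \<in> {1..n}" "u (k + 1) \<noteq> u k" using perm_in[OF u] kk desc by auto
  let ?e = "E (swapped u k) k" and ?f = "E (swapped u k) (k + 1)"
  note ef = flip_tile_edges(3,4)[OF u k desc, folded t_def]
  have bent: "bent (P u (k - 1)) (u (k + 1)) (u k) = ?e \<union> ?f"
    unfolding bent_def E_swapped(2)[OF k(1) k(1)] E_swapped(3)[OF k(1) k(1)] ..
  have "s \<inter> t \<subseteq> ?e \<union> ?f"
    using flip_tile_left_of(1)[OF u k desc] s(1) unfolding bent t_def by blast
  then have eq: "s \<inter> t = (s \<inter> ?e) \<union> (s \<inter> ?f)"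
    using face_of_imp_subset[OF ef(1)] face_of_imp_subset[OF ef(2)] by blast
  have cv: "convex ((s \<inter> ?e) \<union> (s \<inter> ?f))"
    unfolding eq[symmetric] t_def by (intro convex_Int s(2) convex_rhombus)
  have "s \<inter> ?e \<subseteq> s \<inter> ?f \<or> s \<inter> ?f \<subseteq> s \<inter> ?e"
  proof (rule convex_subset_bent[OF ij _ _ cv])
    show "s \<inter> ?e \<subseteq> closed_segment (P u (k - 1)) (P u (k - 1) + v (u (k + 1)))"
      unfolding E_swapped(2)[OF k(1) k(1)] by blast
    show "s \<inter> ?f \<subseteq> closed_segment (P u (k - 1) + v (u (k + 1))) (P u (k - 1) + v (u (k + 1)) + v (u k))"
      unfolding E_swapped(3)[OF k(1) k(1)] by blast
    show "P u (k - 1) + v (u (k + 1)) \<in> s \<inter> ?e \<longleftrightarrow> P u (k - 1) + v (u (k + 1)) \<in> s \<inter> ?f"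
      unfolding E_swapped(2)[OF k(1) k(1)] E_swapped(3)[OF k(1) k(1)] by simp
  qed
  then have "s \<inter> t = s \<inter> ?e \<or> s \<inter> t = s \<inter> ?f" using eq by blast
  then show "(s \<inter> t) face_of s" "(s \<inter> t) face_of t"
    using faces[OF kk(1)] faces[OF kk(2)] face_of_trans[OF _ ef(1)] face_of_trans[OF _ ef(2)] by (metis, metis)
qed

text \<open>Earlier edges of the path lie at or above the top vertex of the tile and later ones at
  or below its bottom vertex. The only possible common point is thus a vertex of both.\<close>

lemma flip_tile_meets_other_edge:
  assumes u: "u permutes {1..n}" and k: "1 \<le> k" "k < n" and desc: "u (k + 1) < u k"
    and m: "m \<in> {1..n}" "m \<noteq> k" "m \<noteq> k + 1"
  defines "t \<equiv> R (P u (k - 1)) (u k) (u (k + 1))"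
  shows "(t \<inter> E u m) face_of t" "(t \<inter> E u m) face_of E u m"
proof -
  let ?p = "P u (k - 1)"
  have kk: "k \<in> {1..n}" "k + 1 \<in> {1..n}" using k by auto
  note neg = Im_v_perm[OF u kk(1)] Im_v_perm[OF u kk(2)]
  have bottom: "P u (k + 1) = ?p + v (u k) + v (u (k + 1))" using P_step[of "k + 1" u] P_step[of k u] k by simp
  obtain x where x: "t \<inter> E u m \<subseteq> {x}" "x extreme_point_of t" "x \<in> E u m \<Longrightarrow> x extreme_point_of (E u m)"
  proof (cases "m < k")
    case True
    then have le: "Im ?p \<le> Im (P u m)" using k by (intro Im_P_le[OF u]) auto
    show ?thesis
    proof (rule that[of ?p])
      show "t \<inter> E u m \<subseteq> {?p}"
      proof
        fix z assume z: "z \<in> t \<inter> E u m"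
        then have "z \<in> R ?p (u k) (u (k + 1))" unfolding t_def by (rule IntD1)
        then obtain a b where ab: "0 \<le> a" "0 \<le> b" "z = ?p + a *\<^sub>R v (u k) + b *\<^sub>R v (u (k + 1))"
          unfolding mem_rhombus by blast
        have "Im (P u m) \<le> Im z" using Im_edge(1)[OF u m(1)] z by blast
        moreover have "Im z = Im ?p + a * Im (v (u k)) + b * Im (v (u (k + 1)))" unfolding ab(3) by simp
        moreover have "a * Im (v (u k)) \<le> 0" "b * Im (v (u (k + 1))) \<le> 0"
          by (rule mult_nonneg_nonpos[OF ab(1) less_imp_le[OF neg(1)]], rule mult_nonneg_nonpos[OF ab(2) less_imp_le[OF neg(2)]])
        ultimately have "a * Im (v (u k)) = 0" "b * Im (v (u (k + 1))) = 0" using le by linarith+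
        then have "a = 0" "b = 0" using neg by auto
        then show "z \<in> {?p}" using ab(3) by simp
      qed
      show "?p extreme_point_of t"
      proof -
        have "?p extreme_point_of E u k" unfolding path_edge_def by (simp only: extreme_point_of_segment simp_thms)
        then show ?thesis
          unfolding extreme_point_of_face[OF flip_tile_edges(1)[OF u k desc]] t_def[symmetric] by (rule conjunct1)
      qed
      assume p: "?p \<in> E u m"
      then have "?p = P u m" using Im_edge(1)[OF u m(1) p] Im_edge(3)[OF u m(1) p] le by simp
      then show "?p extreme_point_of (E u m)"
        unfolding path_edge_def by (simp only: extreme_point_of_segment simp_thms)
    qed
  next
    case False
    then have "k + 1 < m" using m by simp
    then have le: "Im (P u (m - 1)) \<le> Im (P u (k + 1))" using m by (intro Im_P_le[OF u]) auto
    show ?thesis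
    proof (rule that[of "P u (k + 1)"])
      show "t \<inter> E u m \<subseteq> {P u (k + 1)}"
      proof
        fix z assume z: "z \<in> t \<inter> E u m"
        then have "z \<in> R ?p (u k) (u (k + 1))" unfolding t_def by (rule IntD1)
        then obtain a b where ab: "a \<le> 1" "b \<le> 1" "z = ?p + a *\<^sub>R v (u k) + b *\<^sub>R v (u (k + 1))"
          unfolding mem_rhombus by blast
        have "Im z \<le> Im (P u (m - 1))" using Im_edge(2)[OF u m(1)] z by blast
        moreover have "Im z = Im (P u (k + 1)) - (1 - a) * Im (v (u k)) - (1 - b) * Im (v (u (k + 1)))"
          unfolding ab(3) bottom by (simp add: algebra_simps)
        moreover have "(1 - a) * Im (v (u k)) \<le> 0" "(1 - b) * Im (v (u (k + 1))) \<le> 0"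
          by (rule mult_nonneg_nonpos[OF _ less_imp_le[OF neg(1)]], simp add: ab(1),
              rule mult_nonneg_nonpos[OF _ less_imp_le[OF neg(2)]], simp add: ab(2))
        ultimately have "(1 - a) * Im (v (u k)) = 0" "(1 - b) * Im (v (u (k + 1))) = 0" using le by linarith+
        then have "a = 1" "b = 1" using neg by auto
        then show "z \<in> {P u (k + 1)}" using ab(3) bottom by simp
      qed
      show "P u (k + 1) extreme_point_of t"
      proof -
        have "P u (k + 1) extreme_point_of E u (k + 1)" unfolding path_edge_def by (simp only: extreme_point_of_segment simp_thms)
        then show ?thesis
          unfolding extreme_point_of_face[OF flip_tile_edges(2)[OF u k desc]] t_def[symmetric] by (rule conjunct1)
      qed
      assume p: "P u (k + 1) \<in> E u m"
      then have "P u (k + 1) = P u (m - 1)" using Im_edge(2)[OF u m(1) p] Im_edge(4)[OF u m(1) p] le by simp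
      then show "P u (k + 1) extreme_point_of (E u m)"
        unfolding path_edge_def by (simp only: extreme_point_of_segment simp_thms)
    qed
  qed
  have "(t \<inter> E u m) face_of t \<and> (t \<inter> E u m) face_of E u m"
  proof (cases "t \<inter> E u m = {}")
    case False
    then have "t \<inter> E u m = {x}" "x \<in> E u m" using x(1) by blast+
    then show ?thesis using x(2,3) by (simp add: face_of_singleton)
  qed simp
  then show "(t \<inter> E u m) face_of t" "(t \<inter> E u m) face_of E u m" by blast+
qed

lemma convex_path_edge: "convex (E u m)"
  by (simp add: path_edge_def)

lemma tiled_convex: "tiled u T \<Longrightarrow> t \<in> T \<Longrightarrow> convex t"
  using tiled_labels convex_rhombus by metis

text \<open>The extra invariant that carries the edge-to-edge condition through the induction: the
  next tile is glued along edges of the current path, so old tiles must meet these edges in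
  faces.\<close>

lemma tiled_edge_faces:
  "tiled u T \<Longrightarrow> s \<in> T \<Longrightarrow> m \<in> {1..n} \<Longrightarrow> (s \<inter> E u m) face_of s \<and> (s \<inter> E u m) face_of E u m"
proof (induction arbitrary: s m rule: tiled.induct)
  case (tiled_flip u k T)
  note flip = tiled_flip.hyps(2-5)
  define t where "t = R (P u (k - 1)) (u k) (u (k + 1))"
  note s = tiled_flip.prems(1)[folded t_def] and m = tiled_flip.prems(2)
  show ?case
  proof (cases "m = k \<or> m = k + 1")
    case False
    then have m': "m \<noteq> k" "m \<noteq> k + 1" by auto
    have Em: "E (swapped u k) m = E u m" by (rule E_swapped(1)) (use m' m flip in auto)
    show ?thesis
    proof (cases "s = t")
      case True
      then show ?thesis using flip_tile_meets_other_edge[OF flip m m'] unfolding t_def by blast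
    next
      case False
      then have "s \<in> T" using s by blast
      then show ?thesis using tiled_flip.IH[OF _ m] unfolding Em by blast
    qed
  next
    case True
    then have Et: "E u m face_of t" using flip_tile_edges(1,2)[OF flip] unfolding t_def by blast
    show ?thesis
    proof (cases "s = t")
      case True
      then have "s \<inter> E u m = E u m" using face_of_imp_subset[OF Et] by blast
      then show ?thesis using Et True face_of_refl[OF convex_path_edge] by simp
    next
      case False
      then have sT: "s \<in> T" using s by blast
      have "s \<subseteq> left_of (swapped u k)" using tiled_subset[OF tiled_flip.hyps(1) sT] by blast
      note F = flip_tile_meets_old_tile[OF flip this tiled_convex[OF tiled_flip.hyps(1) sT]
          tiled_flip.IH[OF sT], folded t_def]
      \<comment> \<open>The edge is a side of the new tile, so an old tile can meet it only inside
        its intersection with that tile.\<close>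
      have eq: "s \<inter> E u m = (s \<inter> t) \<inter> E u m" using face_of_imp_subset[OF Et] by blast
      have "((s \<inter> t) \<inter> E u m) face_of t" by (rule face_of_Int[OF F(2) Et])
      then have "((s \<inter> t) \<inter> E u m) face_of (s \<inter> t)" "((s \<inter> t) \<inter> E u m) face_of E u m"
        using face_of_imp_subset[OF Et] by (auto elim!: face_of_subset)
      then show ?thesis unfolding eq using face_of_trans[OF _ F(1)] by blast
    qed
  qed
qed simp

lemma tiled_faces:
  "tiled u T \<Longrightarrow> \<forall>s\<in>T. \<forall>t\<in>T. (s \<inter> t) face_of s \<and> (s \<inter> t) face_of t"
proof (induction rule: tiled.induct)
  case (tiled_flip u k T)
  define t where "t = R (P u (k - 1)) (u k) (u (k + 1))"
  have old: "(s \<inter> t) face_of s \<and> (s \<inter> t) face_of t" if s: "s \<in> T" for s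
  proof -
    have "s \<subseteq> left_of (swapped u k)" using tiled_subset[OF tiled_flip.hyps(1) s] by blast
    note F = flip_tile_meets_old_tile[OF tiled_flip.hyps(2-5) this tiled_convex[OF tiled_flip.hyps(1) s]
        tiled_edge_faces[OF tiled_flip.hyps(1) s], folded t_def]
    show ?thesis using F by blast
  qed
  have "t face_of t" unfolding t_def by (rule face_of_refl[OF convex_rhombus])
  then show ?case using tiled_flip.IH old unfolding t_def[symmetric] by (simp add: Int_commute)
qed simp

text \<open>A left edge not covered by tiles would still be an edge of \<open>w\<close>, and its
  midpoint would put the right boundary on the left one. Hence the left boundary is covered and no
  exceptional set remains.\<close>

lemma tiled_rhombic_tiling:
  assumes fs: "fully_supported n w" and w: "w permutes {1..n}" and T: "tiled w T"
  shows "T \<in> rhombic_tilings n \<theta> w"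
proof -
  have "E id m \<subseteq> \<Union>T" if m: "m \<in> {1..n}" for m
  proof (rule ccontr)
    assume "\<not> E id m \<subseteq> \<Union>T"
    then have "E w m = E id m" using tiled_left_edges[OF T m] by simp
    moreover have "P w (m - 1) + (1/2) *\<^sub>R v (w m) \<in> E w m"
      using mem_edge[of m _ w] m by (auto intro!: exI[of _ "1/2"])
    ultimately have "P w (m - 1) + (1/2) *\<^sub>R v (w m) \<in> trail id" using edge_subset_trail[OF m] by blast
    then show False using fully_supported_not_on_left[OF fs w m, of "1/2"] by simp
  qed
  then have "trail id \<subseteq> \<Union>T" unfolding trail_def by blast
  then have "\<Union>T = elnitsky_polygon n \<theta> w"
    using tiled_covers[OF T] tiled_subset[OF T] unfolding elnitsky_polygon_eq[OF w] by blast
  moreover have "\<forall>t\<in>T. \<exists>i\<in>{1..n}. \<exists>j\<in>{1..n}. i \<noteq> j \<and> has_labels \<theta> t i j"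
    using tiled_labels[OF T] unfolding has_labels_def by meson
  ultimately show ?thesis
    unfolding rhombic_tilings_def
    using tiled_finite[OF T] tiled_interior_disjoint[OF T] tiled_faces[OF T] by simp
qed

end

subsection \<open>Forced right-perimeter tiles\<close>

lemma permutes_ascending_id:
  fixes u :: "nat \<Rightarrow> nat"
  assumes u: "u permutes {1..n}" and asc: "\<And>k. 1 \<le> k \<Longrightarrow> k < n \<Longrightarrow> u k < u (k + 1)"
  shows "u = id"
proof -
  have ge: "k + 1 \<le> u (k + 1)" if "k < n" for k
    using that
  proof (induction k)
    case 0
    then have "u 1 \<in> {1..n}" using permutes_in_image[OF u, of 1] by simp
    then show ?case by simp
  next
    case (Suc k)
    then show ?case using asc[of "k + 1"] by simp
  qed
  \<comment> \<open>Both sides run over the same values, so the termwise inequality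
    \<open>k \<le> u k\<close> must be an equality throughout.\<close>
  have "(\<Sum>k=1..n. k) = (\<Sum>k=1..n. u k)" using sum.permute[OF u, of "\<lambda>k. k"] by (simp add: o_def)
  moreover have "k \<le> u k" if "k \<in> {1..n}" for k using ge[of "k - 1"] that by auto
  ultimately have "k = u k" if "k \<in> {1..n}" for k
    using sum_mono_inv[of "\<lambda>k. k" "{1..n}" u k] that by blast
  then have "u k = id k" for k using permutes_not_in[OF u, of k] by (cases "k \<in> {1..n}") auto
  then show ?thesis by blast
qed

context elnitsky
begin

lemma tiled_exists:
  assumes "u permutes {1..n}" shows "\<exists>T. tiled u T"
  using assms
proof (induction "weight n u" arbitrary: u rule: less_induct)
  case less
  show ?case
  proof (cases "u = id")
    case True
    then show ?thesis using tiled_id by blast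
  next
    case False
    have "\<exists>k. 1 \<le> k \<and> k < n \<and> \<not> u k < u (k + 1)"
    proof (rule ccontr)
      assume no: "\<not> ?thesis"
      have "u = id" by (rule permutes_ascending_id[OF less.prems]) (use no in simp)
      then show False using False by simp
    qed
    then obtain k where k: "1 \<le> k" "k < n" "\<not> u k < u (k + 1)" by (elim exE conjE)
    have "u k \<noteq> u (k + 1)" using injD[OF permutes_inj[OF less.prems], of k "k + 1"] by auto
    then have desc: "u (k + 1) < u k" using k(3) by simp
    have "\<exists>T. tiled (swapped u k) T"
      by (rule less.hyps[OF weight_swapped[of k u, OF k(1,2) desc] swapped_permutes[OF less.prems k(1,2)]])
    then obtain T where "tiled (swapped u k) T" by (elim exE)
    then show ?thesis by (intro exI) (rule tiled_flip[OF _ less.prems k(1,2) desc])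
  qed
qed

text \<open>The larger value is moved right until it stands next to \<open>u k\<close>, where the
  exchange produces the tile. If \<open>u (j + 1)\<close> also exceeds \<open>u k\<close>, it takes
  over that role; otherwise it is smaller than \<open>u j\<close> and the two are exchanged. Such
  exchanges change neither \<open>u k\<close> nor the vertex \<open>P u (k - 1)\<close>.\<close>

lemma tiled_with_up_tile:
  assumes "u permutes {1..n}" "1 \<le> j" "j < k" "k \<le> n" "u k < u j"
  shows "\<exists>T z. tiled u T \<and> z \<in> {1..n} \<and> u k < z \<and> R (P u (k - 1) - v z) z (u k) \<in> T"
  using assms
proof (induction "k - j" arbitrary: u j rule: less_induct)
  case less
  note u = less.prems(1)
  have j: "1 \<le> j" "j < n" using less.prems by auto
  show ?case
  proof (cases "j + 1 = k")
    case True
    have desc: "u (j + 1) < u j" using less.prems True by simp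
    obtain T where T: "tiled (swapped u j) T" using tiled_exists[OF swapped_permutes[OF u j]] by blast
    have "P u (k - 1) - v (u j) = P u (j - 1)" using P_step[of j u] j True by auto
    then have "R (P u (k - 1) - v (u j)) (u j) (u k) = R (P u (j - 1)) (u j) (u (j + 1))"
      using True by simp
    moreover have "u j \<in> {1..n}" using perm_in[OF u] j by simp
    ultimately show ?thesis using tiled_flip[OF T u j desc] less.prems(5) by (metis insertI1)
  next
    case False
    then have jk: "j + 1 < k" using less.prems by simp
    show ?thesis
    proof (cases "u k < u (j + 1)")
      case True
      then show ?thesis using less.hyps[of "j + 1" u] less.prems jk by simp
    next
      case ge: False
      then have desc: "u (j + 1) < u j" using less.prems by simp
      have uk: "swapped u j k = u k" by (rule swapped_apply(3)) (use jk in auto)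
      have Pk: "P (swapped u j) (k - 1) = P u (k - 1)" by (rule P_swapped(1)) (use jk j in auto)
      have "\<exists>T z. tiled (swapped u j) T \<and> z \<in> {1..n} \<and> swapped u j k < z \<and>
          R (P (swapped u j) (k - 1) - v z) z (swapped u j k) \<in> T"
      proof (rule less.hyps[OF _ swapped_permutes[OF u j] _ jk less.prems(4)])
        show "swapped u j k < swapped u j (j + 1)" unfolding uk swapped_apply(2) by (rule less.prems(5))
      qed (use jk in auto)
      then obtain T z where "tiled (swapped u j) T" "z \<in> {1..n}" "u k < z" "R (P u (k - 1) - v z) z (u k) \<in> T"
        unfolding uk Pk by (elim exE conjE)
      then show ?thesis using tiled_flip[of u j T, OF _ u j desc] by (meson insertI2)
    qed
  qed
qed

text \<open>The mirror image: a smaller value on the right is moved left until it stands next to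
  \<open>u k\<close>.\<close>

lemma tiled_with_down_tile:
  assumes "u permutes {1..n}" "1 \<le> k" "k < j" "j \<le> n" "u j < u k"
  shows "\<exists>T z. tiled u T \<and> z \<in> {1..n} \<and> z < u k \<and> R (P u (k - 1)) (u k) z \<in> T"
  using assms
proof (induction "j - k" arbitrary: u j rule: less_induct)
  case less
  note u = less.prems(1)
  define i where "i = j - 1"
  have ij: "j = i + 1" using less.prems by (simp add: i_def)
  have i: "1 \<le> i" "i < n" using less.prems by (auto simp: i_def)
  show ?case
  proof (cases "i = k")
    case True
    have desc: "u (i + 1) < u i" using less.prems ij True by simp
    obtain T where T: "tiled (swapped u i) T" using tiled_exists[OF swapped_permutes[OF u i]] by blast
    have "u j \<in> {1..n}" using perm_in[OF u] less.prems by simp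
    then show ?thesis using tiled_flip[OF T u i desc] less.prems(5) unfolding ij True by (metis insertI1)
  next
    case False
    then have ki: "k < i" using less.prems ij by simp
    show ?thesis
    proof (cases "u i < u k")
      case True
      then show ?thesis using less.hyps[of i u] less.prems ki i ij by simp
    next
      case ge: False
      then have desc: "u (i + 1) < u i" using less.prems ij by simp
      have uk: "swapped u i k = u k" by (rule swapped_apply(3)) (use ki in auto)
      have Pk: "P (swapped u i) (k - 1) = P u (k - 1)" by (rule P_swapped(1)) (use ki i in auto)
      have "\<exists>T z. tiled (swapped u i) T \<and> z \<in> {1..n} \<and> z < swapped u i k \<and>
          R (P (swapped u i) (k - 1)) (swapped u i k) z \<in> T"
      proof (rule less.hyps[OF _ swapped_permutes[OF u i] less.prems(2) ki])
        show "swapped u i i < swapped u i k" unfolding uk swapped_apply(1) using less.prems(5) ij by simp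
      qed (use ki i ij in auto)
      then obtain T z where "tiled (swapped u i) T" "z \<in> {1..n}" "z < u k" "R (P u (k - 1)) (u k) z \<in> T"
        unfolding uk Pk by (elim exE conjE)
      then show ?thesis using tiled_flip[of u i T, OF _ u i desc] by (meson insertI2)
    qed
  qed
qed

text \<open>Both tiles lie to the left of the edge from \<open>q\<close> to \<open>q + v a\<close>,
  so they share the points just left of its midpoint.\<close>

lemma edge_tiles_overlap:
  assumes a: "a \<in> {1..n}" and y: "y \<in> {1..n}" "y < a" and z: "z \<in> {1..n}" "a < z"
  obtains q' where "q' \<in> interior (R q a y)" "q' \<in> R (q - v z) z a"
proof -
  obtain A B where AB: "A > 0" "B > 0" "\<And>r. of_real r = (r * A) *\<^sub>R v a - (r * B) *\<^sub>R v y"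
    using unit_right[OF a y] by metis
  obtain C D where CD: "C > 0" "D > 0" "\<And>r. of_real r = (r * C) *\<^sub>R v z - (r * D) *\<^sub>R v a"
    using unit_right[OF z(1) a z(2)] by metis
  \<comment> \<open>Makes the four products below add up to 1/4, so that each coordinate moves by
    less than 1/2.\<close>
  define r where "r = 1 / (4 * (A + B + C + D))"
  have sum: "A + B + C + D > 0" using AB(1,2) CD(1,2) by linarith
  then have r: "r > 0" by (simp add: r_def)
  have "r * (A + B + C + D) = 1/4" unfolding r_def using sum by (simp add: divide_simps)
  then have "r * A + r * B + r * C + r * D = 1/4" by (simp only: distrib_left)
  moreover have pos: "r * A > 0" "r * B > 0" "r * C > 0" "r * D > 0" using r AB(1,2) CD(1,2) by simp_all
  ultimately have small: "r * A < 1/2" "r * B < 1/2" "r * C < 1/2" "r * D < 1/2" by linarith+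
  let ?m = "q + (1/2) *\<^sub>R v a - of_real r"
  have "q + (1/2 - r * A) *\<^sub>R v a + (r * B) *\<^sub>R v y \<in> interior (R q a y)"
    using pos small by (intro interior_rhombus a y) (use y in auto)
  moreover have "q + (1/2 - r * A) *\<^sub>R v a + (r * B) *\<^sub>R v y = ?m"
    unfolding AB(3) by (simp add: algebra_simps)
  ultimately have "?m \<in> interior (R q a y)" by simp
  moreover have "?m = q - v z + (1 - r * C) *\<^sub>R v z + (1/2 + r * D) *\<^sub>R v a"
    unfolding CD(3) by (simp add: algebra_simps)
  then have "?m \<in> R (q - v z) z a" unfolding mem_rhombus using pos small
    by (intro exI[of _ "1 - r * C"] exI[of _ "1/2 + r * D"]) auto
  ultimately show ?thesis using that by blast
qed

end

context elnitsky_tiling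
begin

lemma edge_tiles_exclusive:
  assumes "a \<in> {1..n}" "y \<in> {1..n}" "y < a" "z \<in> {1..n}" "a < z"
    and "R q a y \<in> T" "R (q - v z) z a \<in> T"
  shows False
proof -
  obtain q' where "q' \<in> interior (R q a y)" "q' \<in> R (q - v z) z a"
    by (rule edge_tiles_overlap[OF assms(1-5)])
  then have "R q a y = R (q - v z) z a" using tile_eqI assms(6,7) by blast
  then have "{a, y} = {z, a}" using rhombus_labels_unique[of a y z a] assms(1-5) by simp
  then show False using assms(3,5) by (auto simp: doubleton_eq_iff)
qed

text \<open>The definition does not say at which position the tile touches the boundary. Its labels
  occur only at \<open>k\<close> and \<open>k + 1\<close>, which fixes the two edges; comparing
  heights then fixes the corner \<open>p\<close>.\<close>

lemma right_perimeter_tile_position: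
  assumes k: "1 \<le> k" "k < n" and desc: "w (k + 1) < w k"
    and t: "has_labels \<theta> t (w k) (w (k + 1))" "right_perimeter_tile n \<theta> w t"
  shows "t = R (P w (k - 1)) (w k) (w (k + 1))"
proof -
  have kk: "k \<in> {1..n}" "k + 1 \<in> {1..n}" using k by auto
  note xy = perm_in[OF w kk(1)] perm_in[OF w kk(2)]
  have ne: "w k \<noteq> w (k + 1)" using desc by simp
  have inj: "w a = w b \<Longrightarrow> a = b" for a b using permutes_inj[OF w] by (auto dest: injD)
  obtain p where tp: "t = R p (w k) (w (k + 1))" using t(1) unfolding has_labels_def by blast
  obtain l where l: "1 \<le> l" "l < n" and "E w l edge_of t" "E w (l + 1) edge_of t"
    using t(2) unfolding right_perimeter_tile_def by blast
  then have faces: "E w l face_of t" "E w (l + 1) face_of t" by (simp_all add: edge_of_def)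
  have ll: "l \<in> {1..n}" "l + 1 \<in> {1..n}" using l by auto
  have f1: "(w l = w k \<and> (P w (l - 1) = p \<or> P w (l - 1) = p + v (w (k + 1)))) \<or>
      (w l = w (k + 1) \<and> (P w (l - 1) = p \<or> P w (l - 1) = p + v (w k)))"
    by (rule rhombus_face_unit_segment[OF xy ne perm_in[OF w ll(1)] faces(1)[unfolded tp E_pair(1)[OF l(1)]]])
  have f2: "(w (l + 1) = w k \<and> (P w (l - 1) + v (w l) = p \<or> P w (l - 1) + v (w l) = p + v (w (k + 1)))) \<or>
      (w (l + 1) = w (k + 1) \<and> (P w (l - 1) + v (w l) = p \<or> P w (l - 1) + v (w l) = p + v (w k)))"
    by (rule rhombus_face_unit_segment[OF xy ne perm_in[OF w ll(2)] faces(2)[unfolded tp E_pair(2)[OF l(1)]]])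
  have "l = k \<or> l = k + 1" using f1 inj by blast
  moreover have "l + 1 = k \<or> l = k" using f2 inj[of "l + 1" k] inj[of "l + 1" "k + 1"] by auto
  ultimately have lk: "l = k" by auto
  have q: "P w (k - 1) = p \<or> P w (k - 1) = p + v (w (k + 1))" using f1 ne unfolding lk by auto
  have q': "P w (k - 1) + v (w k) = p \<or> P w (k - 1) + v (w k) = p + v (w k)" using f2 ne unfolding lk by auto
  have neg: "Im (v (w k)) < 0" "Im (v (w (k + 1))) < 0" using Im_v xy by blast+
  have "P w (k - 1) = p"
    using q'
  proof
    assume "P w (k - 1) + v (w k) = p"
    then have "Im p = Im (P w (k - 1)) + Im (v (w k))" by (metis plus_complex.sel(2))
    moreover have "Im (P w (k - 1)) = Im p \<or> Im (P w (k - 1)) = Im p + Im (v (w (k + 1)))"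
      using q by (metis plus_complex.sel(2))
    ultimately show ?thesis using neg by linarith
  qed simp
  then show ?thesis using tp by simp
qed

end

context elnitsky
begin

text \<open>The perimeter tile at \<open>k\<close> extends below edge \<open>k\<close> and above
  edge \<open>k + 1\<close>. A tiling with a tile extending above edge \<open>k\<close>, or below
  edge \<open>k + 1\<close>, excludes it by overlap.\<close>

lemma not_forced:
  assumes fs: "fully_supported n w" and w: "w permutes {1..n}" and k: "1 \<le> k" "k < n" and desc: "w (k + 1) < w k"
    and pattern: "(\<exists>j. 1 \<le> j \<and> j < k \<and> w k < w j) \<or> (\<exists>j. k + 1 < j \<and> j \<le> n \<and> w j < w (k + 1))"
  shows "\<not> forced_right_perimeter_tile n \<theta> w (w k) (w (k + 1))"
proof
  assume forced: "forced_right_perimeter_tile n \<theta> w (w k) (w (k + 1))"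
  have xy: "w k \<in> {1..n}" "w (k + 1) \<in> {1..n}" using perm_in[OF w] k by auto
  have Pk: "P w (k - 1) = P w k - v (w k)" using P_step[of k w] k by simp
  from pattern show False
  proof
    assume "\<exists>j. 1 \<le> j \<and> j < k \<and> w k < w j"
    then obtain T z where "tiled w T" and z: "z \<in> {1..n}" "w k < z" "R (P w (k - 1) - v z) z (w k) \<in> T"
      using tiled_with_up_tile[OF w] k by (meson less_imp_le)
    then have tiling: "T \<in> rhombic_tilings n \<theta> w" using tiled_rhombic_tiling[OF fs w] by blast
    interpret elnitsky_tiling n \<theta> w T by unfold_locales (rule w, rule tiling)
    obtain t where "t \<in> T" "has_labels \<theta> t (w k) (w (k + 1))" "right_perimeter_tile n \<theta> w t"
      using forced tiling unfolding forced_right_perimeter_tile_def by blast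
    then have "R (P w (k - 1)) (w k) (w (k + 1)) \<in> T" using right_perimeter_tile_position[OF k desc] by blast
    then show False using edge_tiles_exclusive[OF xy desc z(1,2) _ z(3)] by blast
  next
    assume "\<exists>j. k + 1 < j \<and> j \<le> n \<and> w j < w (k + 1)"
    then obtain j where j: "k + 1 < j" "j \<le> n" "w j < w (k + 1)" by blast
    then obtain T z where "tiled w T" and z: "z \<in> {1..n}" "z < w (k + 1)" "R (P w k) (w (k + 1)) z \<in> T"
      using tiled_with_down_tile[OF w, of "k + 1" j] k by auto
    then have tiling: "T \<in> rhombic_tilings n \<theta> w" using tiled_rhombic_tiling[OF fs w] by blast
    interpret elnitsky_tiling n \<theta> w T by unfold_locales (rule w, rule tiling)
    obtain t where "t \<in> T" "has_labels \<theta> t (w k) (w (k + 1))" "right_perimeter_tile n \<theta> w t"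
      using forced tiling unfolding forced_right_perimeter_tile_def by blast
    then have "R (P w k - v (w k)) (w k) (w (k + 1)) \<in> T"
      using right_perimeter_tile_position[OF k desc] unfolding Pk by blast
    then show False using edge_tiles_exclusive[OF xy(2) z(1,2) xy(1) desc z(3)] by blast
  qed
qed

end

section \<open>Patterns, maxima and minima at given positions\<close>

lemma together_in_321_pattern_consecutive:
  assumes w: "w permutes {1..n}" and k: "1 \<le> k" "k < n" and desc: "w (k + 1) < w k"
  shows "together_in_321_pattern n w (w k) (w (k + 1)) \<longleftrightarrow>
    (\<exists>j. 1 \<le> j \<and> j < k \<and> w k < w j) \<or> (\<exists>j. k + 1 < j \<and> j \<le> n \<and> w j < w (k + 1))"
    (is "?L \<longleftrightarrow> ?before \<or> ?after")
proof
  assume ?L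
  then obtain a b c where abc: "1 \<le> a" "a < b" "b < c" "c \<le> n" "w a > w b" "w b > w c"
    and sub: "{w k, w (k + 1)} \<subseteq> {w a, w b, w c}"
    unfolding together_in_321_pattern_def by blast
  have inj: "w i = w j \<longleftrightarrow> i = j" for i j using permutes_inj[OF w] by (auto dest: injD)
  have "k \<in> {a, b, c}" "k + 1 \<in> {a, b, c}" using sub by (auto simp: inj)
  then consider "k = a" "k + 1 = b" | "k = b" "k + 1 = c" using abc by auto
  then show "?before \<or> ?after"
  proof cases
    case 1
    then have "k + 1 < c \<and> c \<le> n \<and> w c < w (k + 1)" using abc by simp
    then show ?thesis by blast
  next
    case 2
    then have "1 \<le> a \<and> a < k \<and> w k < w a" using abc by simp
    then show ?thesis by blast
  qed
next
  assume "?before \<or> ?after"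
  then show ?L
  proof
    assume ?before
    then obtain j where "1 \<le> j" "j < k" "w k < w j" by blast
    then show ?L unfolding together_in_321_pattern_def
      using k desc by (intro exI[of _ j] exI[of _ k] exI[of _ "k + 1"]) auto
  next
    assume ?after
    then obtain j where "k + 1 < j" "j \<le> n" "w j < w (k + 1)" by blast
    then show ?L unfolding together_in_321_pattern_def
      using k desc by (intro exI[of _ k] exI[of _ "k + 1"] exI[of _ j]) auto
  qed
qed

lemma left_to_right_maximum_at:
  assumes w: "w permutes {1..n}" and k: "1 \<le> k" "k \<le> n"
  shows "left_to_right_maximum n w (w k) \<longleftrightarrow> \<not> (\<exists>j. 1 \<le> j \<and> j < k \<and> w k < w j)"
proof -
  have inj: "w i = w j \<longleftrightarrow> i = j" for i j using permutes_inj[OF w] by (auto dest: injD)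
  have "w j < w k \<longleftrightarrow> \<not> w k < w j" if "j < k" for j using inj[of j k] that by auto
  then show ?thesis unfolding left_to_right_maximum_def using k by (auto simp: inj)
qed

lemma right_to_left_minimum_at:
  assumes w: "w permutes {1..n}" and k: "1 \<le> k" "k \<le> n"
  shows "right_to_left_minimum n w (w k) \<longleftrightarrow> \<not> (\<exists>j. k < j \<and> j \<le> n \<and> w j < w k)"
proof -
  have inj: "w i = w j \<longleftrightarrow> i = j" for i j using permutes_inj[OF w] by (auto dest: injD)
  have "w k < w j \<longleftrightarrow> \<not> w j < w k" if "k < j" for j using inj[of j k] that by auto
  then show ?thesis unfolding right_to_left_minimum_def using k by (auto simp: inj)
qed

theorem theorem4p7:
  fixes n k x y :: nat and w :: "nat \<Rightarrow> nat" and \<theta> :: "nat \<Rightarrow> real"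
  assumes "n \<ge> 2"
    and "w permutes {1..n}"
    and "fully_supported n w"
    and "elnitsky_angles n \<theta>"
    and "1 \<le> k" and "k \<le> n - 1"
    and "x = w k" and "y = w (k + 1)"
    and "x > y"
  shows "(forced_right_perimeter_tile n \<theta> w x y \<longleftrightarrow> \<not> together_in_321_pattern n w x y) \<and>
         (\<not> together_in_321_pattern n w x y \<longleftrightarrow>
            left_to_right_maximum n w x \<and> right_to_left_minimum n w y)"
proof -
  interpret elnitsky n \<theta> by unfold_locales (use assms in auto)
  note w = assms(2)
  have k: "1 \<le> k" "k < n" using assms by auto
  have desc: "w (k + 1) < w k" using assms by simp
  have pattern: "together_in_321_pattern n w x y \<longleftrightarrow>
    (\<exists>j. 1 \<le> j \<and> j < k \<and> w k < w j) \<or> (\<exists>j. k + 1 < j \<and> j \<le> n \<and> w j < w (k + 1))"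
    unfolding assms(7,8) by (rule together_in_321_pattern_consecutive[OF w k desc])
  have "forced_right_perimeter_tile n \<theta> w x y" if no: "\<not> together_in_321_pattern n w x y"
    unfolding forced_right_perimeter_tile_def
  proof
    fix T assume "T \<in> rhombic_tilings n \<theta> w"
    then interpret elnitsky_tiling n \<theta> w T by unfold_locales (use w in auto)
    have ne: "w j \<noteq> w i" if "j \<noteq> i" for i j using permutes_inj[OF w] that by (auto dest: injD)
    show "\<exists>t\<in>T. has_labels \<theta> t x y \<and> right_perimeter_tile n \<theta> w t"
      unfolding assms(7,8)
    proof (rule right_perimeter_tile_exists[OF assms(3) k desc])
      show "w j < w k" if "1 \<le> j" "j < k" for j using no that ne[of j k] unfolding pattern by force
      show "w (k + 1) < w j" if "k + 1 < j" "j \<le> n" for j using no that ne[of j "k + 1"] unfolding pattern by force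
    qed
  qed
  moreover have "\<not> forced_right_perimeter_tile n \<theta> w x y" if "together_in_321_pattern n w x y"
    unfolding assms(7,8) by (rule not_forced[OF assms(3) w k desc that[unfolded pattern]])
  moreover have "\<not> together_in_321_pattern n w x y \<longleftrightarrow> left_to_right_maximum n w x \<and> right_to_left_minimum n w y"
    unfolding pattern unfolding assms(7,8)
    using left_to_right_maximum_at[OF w, of k] right_to_left_minimum_at[OF w, of "k + 1"] k
    by auto
  ultimately show ?thesis by blast
qed

end
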